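(* Let $k$ and $\ell$ be positive integers and write $m:=2^{\mathrm{ord}_2(\gcd(k,\ell))}$. Suppose that $q:=2^k$ and $Q:=2^\ell$ satisfy $\gcd(Q+1,q+1)=1$. Write $A(X):=1+bX^v+cX^u$ where $b,c\in\mathbb{F}_{q^2}$ and $u,v$ are positive integers such that $u(Q+1)\equiv 1\pmod{q+1}$ and $v(Q+1)\equiv Q\pmod{q+1}$. Then $f(X):=XA(X^{q-1})$ permutes $\mathbb{F}_{q^2}$ if and only if all of the following hold: (1) $e:=1+b^{q+1}+c^{q+1}$ is nonzero; (2) $c^Q=e^{Q-1}b$; (3) $\mathrm{Tr}_{\mathbb{F}_q/\mathbb{F}_{2^m}}\bigl(\frac1e\bigr)=\frac{k}{m}$.
   Context: For a positive integer $n$, $\mathrm{ord}_2(n)$ is the largest integer $i\ge0$ with $2^i\mid n$. A polynomial permutes $\mathbb{F}_{q^2}$ if it induces a bijection of $\mathbb{F}_{q^2}$. $\mathrm{Tr}_{\mathbb{F}_q/\mathbb{F}_{2^m}}$ is the trace map (note $m\mid k$), and the integer $k/m$ is viewed as an element of $\mathbb{F}_2\subseteq\mathbb{F}_{2^m}$. *)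

theory Defs
  imports "HOL-Computational_Algebra.Computational_Algebra" "HOL-Number_Theory.Cong"
    "HOL-Library.Cardinality"
begin

definition permutes_field :: "'a::field poly \<Rightarrow> bool" where
  "permutes_field f \<longleftrightarrow> bij (poly f)"

text \<open>The trace map from the field with \<open>r ^ n\<close> elements to its subfield with \<open>r\<close> elements,
  as the sum of the conjugates. The two fields are not separate types: they are the subfields
  \<open>{x. x ^ (r ^ n) = x}\<close> and \<open>{x. x ^ r = x}\<close> of the ambient finite field, and the value is
  meaningful only for \<open>x\<close> in the former.\<close>

definition finite_field_trace :: "nat \<Rightarrow> nat \<Rightarrow> 'a::field \<Rightarrow> 'a" where
  "finite_field_trace r n x = (\<Sum>i<n. x ^ (r ^ i))"

end

theory Submission
  imports Defs
begin

text \<open>Write \<open>D y = 1 + b y\<^sup>Q + c y\<close> and let \<open>\<mu>\<close> be the group of \<open>(q + 1)\<close>-st roots of unity. With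
  \<open>y\<^bsup>Q+1\<^esup> = x\<^bsup>q-1\<^esup>\<close> one has \<open>f x = x D y\<close>, so \<open>f\<close> permutes the field iff \<open>D\<close> has no zero on \<open>\<mu>\<close> and
  \<open>g y = y\<^bsup>Q+1\<^esup> (D y)\<^bsup>q-1\<^esup> = N y / D y\<close> is injective there. The numerator of the derivative of \<open>N / D\<close> is the
  \<open>Q\<close>-th power of a quadratic polynomial with roots \<open>r\<close> and \<open>r'\<close> in the field; an Artin--Schreier
  parameter \<open>a\<close> decides whether \<open>q\<close>-th power conjugation maps \<open>r\<close> to \<open>1 / r'\<close> (\<open>a\<^sup>q = a\<close>)
  or to \<open>1 / r\<close> (\<open>a\<^sup>q = a + 1\<close>).

  Necessity of condition (2): if \<open>r, r' \<in> \<mu>\<close>, injectivity forces the fibres through them to be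
  totally ramified. Otherwise some combination of \<open>N\<close> and \<open>D\<close> has the form
  \<open>(y + r)\<^sup>Q (s (y + r) + t (1 + r\<^sup>q y))\<close>. As \<open>g\<close> permutes \<open>\<mu>\<close>, a power sum in the style of Hermite's criterion
  vanishes; it equals a single monomial in \<open>s\<close> and \<open>t\<close>, so \<open>s = 0\<close> or \<open>t = 0\<close>.

  Under condition (2), \<open>1 / e\<close> is \<open>a\<^sup>Q + a + 1\<close> or \<open>a\<^sup>Q + a\<close>, and in the coordinate
  \<open>(y + r) / (y + r')\<close> the function \<open>g\<close> becomes \<open>X\<^bsup>Q+1\<^esup>\<close> or \<open>X\<^bsup>Q-1\<^esup>\<close> respectively, on a coset of
  \<open>\<mu>\<close> or on a projective line over the field of \<open>q\<close> elements. Its injectivity is then a question about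
  \<open>gcd (Q \<plusminus> 1) (q \<plusminus> 1)\<close>, which the trace of \<open>1 / e\<close> answers; only for the exponent \<open>Q - 1\<close> and
  \<open>r \<in> \<mu>\<close> it fails regardless, because \<open>D\<close> vanishes at \<open>r\<close>.\<close>

section \<open>Finite fields\<close>

lemma finite_field_power_card_minus_1:
  fixes x :: "'a::{field,finite}"
  assumes "x \<noteq> 0"
  shows "x ^ (CARD('a) - 1) = 1"
proof -
  have "bij_betw ((*) x) (UNIV - {0}) (UNIV - {0})"
    by (rule bij_betwI[where g = "\<lambda>y. y / x"]) (use assms in auto)
  then have "(\<Prod>y\<in>UNIV - {0}. x * y) = (\<Prod>y\<in>UNIV - {0}. y)"
    by (rule prod.reindex_bij_betw)
  then show ?thesis
    by (simp add: prod.distrib card_Diff_singleton)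
qed

lemma finite_field_power_card:
  fixes x :: "'a::{field,finite}"
  shows "x ^ CARD('a) = x"
proof (cases "x = 0")
  case True
  then show ?thesis by (simp add: zero_power)
next
  case False
  have "x ^ CARD('a) = x ^ (CARD('a) - 1) * x"
    by (rule power_minus_mult[symmetric]) simp
  then show ?thesis
    using finite_field_power_card_minus_1[OF False] by simp
qed

text \<open>Otherwise \<open>X ^ n - 1\<close>, nonzero of degree at most \<open>n\<close>, would
  vanish at all \<open>CARD('a) - 1\<close> nonzero elements.\<close>

lemma ex_power_neq_1:
  assumes "0 < n" "n < CARD('a::{field,finite}) - 1"
  shows "\<exists>x::'a. x \<noteq> 0 \<and> x ^ n \<noteq> 1"
proof (rule ccontr)
  assume *: "\<not> ?thesis"
  let ?p = "monom 1 n - 1 :: 'a poly"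
  have "coeff ?p n = 1"
    using assms by simp
  then have nz: "?p \<noteq> 0"
    by (metis coeff_0 one_neq_zero)
  have "UNIV - {0} \<subseteq> {x. poly ?p x = 0}"
    using * by (auto simp: poly_monom)
  then have "CARD('a) - 1 \<le> card {x. poly ?p x = 0}"
    using card_mono[of "{x. poly ?p x = 0}" "UNIV - {0}"] by (simp add: card_Diff_singleton)
  also have "\<dots> \<le> degree ?p"
    using nz by (rule card_poly_roots_bound)
  also have "\<dots> \<le> n"
    by (intro degree_diff_le) (auto simp: degree_monom_le)
  finally show False using assms by simp
qed

lemma ex_root_of_unity:
  assumes "N dvd CARD('a::{field,finite}) - 1" "N > 1"
  shows "\<exists>z::'a. z \<noteq> 1 \<and> z ^ N = 1"
proof -
  have "card {0, 1 :: 'a} \<le> CARD('a)"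
    by (rule card_mono) auto
  then have "CARD('a) - 1 > 0" by simp
  moreover obtain n where n: "CARD('a) - 1 = N * n"
    using assms by auto
  ultimately have "0 < n" "n < CARD('a) - 1"
    using assms by (auto intro!: Nat.gr0I)
  then obtain x :: 'a where x: "x \<noteq> 0" "x ^ n \<noteq> 1"
    using ex_power_neq_1 by blast
  have "(x ^ n) ^ N = 1"
    using finite_field_power_card_minus_1[OF x(1)] n by (simp add: power_mult[symmetric] mult.commute)
  with x show ?thesis by blast
qed

text \<open>Replacing \<open>x\<close> by \<open>z * x\<close>, where
  \<open>z ^ j \<noteq> 1\<close>, multiplies the sum by \<open>z ^ j\<close> but only permutes its
  terms.\<close>

lemma sum_power_finite_field:
  assumes "\<not> (CARD('a::{field,finite}) - 1) dvd j"
  shows "(\<Sum>x\<in>UNIV - {0::'a}. x ^ j) = 0"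
proof -
  let ?c = "CARD('a) - 1"
  have red: "x ^ j = x ^ (j mod ?c)" if "x \<noteq> 0" for x :: 'a
  proof -
    have "x ^ j = x ^ (?c * (j div ?c) + j mod ?c)" by simp
    also have "\<dots> = x ^ (j mod ?c)"
      unfolding power_add power_mult finite_field_power_card_minus_1[OF that] by simp
    finally show ?thesis .
  qed
  have "card {0, 1 :: 'a} \<le> CARD('a)"
    by (rule card_mono) auto
  then have "?c > 0" by simp
  with assms have "0 < j mod ?c" "j mod ?c < ?c"
    by (auto simp: mod_greater_zero_iff_not_dvd)
  then obtain z :: 'a where z: "z \<noteq> 0" "z ^ j \<noteq> 1"
    using ex_power_neq_1 red by metis
  have "bij_betw ((*) z) (UNIV - {0}) (UNIV - {0})"
    by (rule bij_betwI[where g = "\<lambda>y. y / z"]) (use z in auto)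
  then have "(\<Sum>x\<in>UNIV - {0}. (z * x) ^ j) = (\<Sum>x\<in>UNIV - {0}. x ^ j)"
    by (rule sum.reindex_bij_betw)
  then have "z ^ j * (\<Sum>x\<in>UNIV - {0}. x ^ j) = (\<Sum>x\<in>UNIV - {0}. x ^ j)"
    by (simp add: power_mult_distrib sum_distrib_left)
  with z show ?thesis by simp
qed

lemma power_eq_1_coprime:
  fixes x :: "'a::field"
  assumes "x ^ m = 1" "x ^ n = 1" "coprime m n"
  shows "x = 1"
proof (cases "m = 0")
  case True
  with assms show ?thesis by simp
next
  case False
  then obtain i j where "m * i = n * j + 1"
    using bezout_nat[of m n] assms by auto
  then have "x ^ (m * i) = x ^ (n * j) * x"
    by simp
  then show ?thesis
    using assms by (simp add: power_mult)
qed

lemma power_eq_coprime: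
  fixes x y :: "'a::field"
  assumes "x ^ m = y ^ m" "x ^ n = y ^ n" "coprime m n" "y \<noteq> 0"
  shows "x = y"
  using power_eq_1_coprime[of "x / y" m n] assms by (simp add: power_divide)

section \<open>Quadratic extensions in characteristic two\<close>

text \<open>The type \<open>'a\<close> is the field with \<open>q ^ 2\<close> elements;
  \<open>K\<close> pins it down, since no numeric parameter mentions it.\<close>

locale quadratic_extension =
  fixes k q :: nat and K :: "'a::{field,finite} itself"
  assumes k_pos: "k > 0" and q_def: "q = 2 ^ k" and card_K: "CARD('a) = q ^ 2"
begin

lemma q_gt_1: "q > 1"
  using k_pos unfolding q_def by (intro one_less_power) auto

lemma even_q: "even q"
  using k_pos by (simp add: q_def)

lemma card_minus_1: "CARD('a) - 1 = (q - 1) * (q + 1)"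
  by (simp add: card_K power2_eq_square algebra_simps)

lemma two_eq_0: "(2::'a) = 0"
proof -
  have "(- 1 :: 'a) ^ CARD('a) = - 1"
    by (rule finite_field_power_card)
  then have "(1::'a) = - 1"
    using even_q by (simp add: card_K)
  then show ?thesis
    by (metis add.right_inverse one_add_one)
qed

lemma add_self [simp]: "x + x = (0::'a)"
  using mult_2[of x] two_eq_0 by simp

lemma add_self_left [simp]: "x + (x + y) = (y::'a)"
  by (simp flip: add.assoc)

lemma add_self_right [simp]: "x + y + y = (x::'a)"
  by (simp add: add.assoc)

lemma uminus_eq: "- x = (x::'a)"
  by (rule minus_unique) simp

lemma minus_eq_plus: "x - y = (x + y :: 'a)"
  by (subst diff_conv_add_uminus) (simp only: uminus_eq)

lemma add_eq_0_iff_eq: "x + y = 0 \<longleftrightarrow> x = (y::'a)"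
  using add_right_cancel[of x y y] by simp

lemma power2_add: "(x + y)\<^sup>2 = x\<^sup>2 + (y\<^sup>2 :: 'a)"
  using two_eq_0 by (simp add: power2_sum)

lemma frobenius: "(x + y) ^ 2 ^ n = (x ^ 2 ^ n + y ^ 2 ^ n :: 'a)"
proof (induction n)
  case (Suc n)
  then show ?case
    by (simp add: power_Suc2 power_mult power2_add del: power_Suc)
qed simp

lemma frobenius_inj: "x ^ 2 ^ n = y ^ 2 ^ n \<Longrightarrow> x = (y::'a)"
  using frobenius[of x y n] by (metis add_eq_0_iff_eq power_eq_0_iff)

lemma frobenius_surj: "\<exists>x::'a. x ^ 2 ^ n = y"
proof -
  have "surj (\<lambda>x::'a. x ^ 2 ^ n)"
    by (intro finite_UNIV_inj_surj injI) (auto dest: frobenius_inj)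
  then show ?thesis by (metis surjD)
qed

text \<open>Conjugation over the subfield with \<open>q\<close> elements, an involution.\<close>

definition cj :: "'a \<Rightarrow> 'a" where
  "cj x = x ^ q"

lemma cj_add: "cj (x + y) = cj x + cj y"
  unfolding cj_def unfolding q_def by (rule frobenius)

lemma cj_mult: "cj (x * y) = cj x * cj y"
  by (simp add: cj_def power_mult_distrib)

lemma cj_divide: "cj (x / y) = cj x / cj y"
  by (simp add: cj_def power_divide)

lemma cj_power: "cj (x ^ n) = cj x ^ n"
  by (simp add: cj_def power_mult[symmetric] mult.commute)

lemma cj_cj [simp]: "cj (cj x) = x"
  using finite_field_power_card[of x] by (simp add: cj_def card_K power2_eq_square power_mult)

lemma cj_0 [simp]: "cj 0 = 0" and cj_1 [simp]: "cj 1 = 1"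
  using q_gt_1 by (simp_all add: cj_def)

lemma cj_eq_0_iff [simp]: "cj x = 0 \<longleftrightarrow> x = 0"
  using q_gt_1 by (simp add: cj_def)

lemma cj_eq_iff [simp]: "cj x = cj y \<longleftrightarrow> x = y"
  by (metis cj_cj)

lemmas cj_simps = cj_add cj_mult cj_divide cj_power

lemma power_q_minus_1: "x \<noteq> 0 \<Longrightarrow> x ^ (q - 1) = cj x / x"
  using q_gt_1 by (simp add: cj_def field_simps flip: power_Suc)

lemma power_q_plus_1: "x ^ (q + 1) = x * cj x"
  by (simp add: cj_def)

text \<open>The elements of norm one: conjugation is inversion on them, and \<open>mu_iff\<close>
  recovers the roots of unity.\<close>

definition mu :: "'a set" where
  "mu = {y. y * cj y = 1}"

lemma mu_iff: "y \<in> mu \<longleftrightarrow> y ^ (q + 1) = 1"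
  by (simp add: mu_def cj_def)

lemma mu_nonzero: "y \<in> mu \<Longrightarrow> y \<noteq> 0"
  by (auto simp: mu_def)

lemma mu_cj: "y \<in> mu \<Longrightarrow> cj y = 1 / y"
  by (simp add: mu_def nonzero_eq_divide_eq mu_nonzero mult.commute)

lemma one_in_mu: "1 \<in> mu"
  by (simp add: mu_def)

lemma mu_mult: "x \<in> mu \<Longrightarrow> y \<in> mu \<Longrightarrow> x * y \<in> mu"
  by (simp add: mu_iff power_mult_distrib del: power_Suc)

lemma mu_divide: "x \<in> mu \<Longrightarrow> y \<in> mu \<Longrightarrow> x / y \<in> mu"
  by (simp add: mu_iff power_divide del: power_Suc)

lemma mu_power: "y \<in> mu \<Longrightarrow> y ^ n \<in> mu"
  by (metis mu_iff power_mult mult.commute power_one)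

lemma mu_power_cong:
  assumes "y \<in> mu" "[i = j] (mod (q + 1))"
  shows "y ^ i = y ^ j"
proof -
  have *: "y ^ i = y ^ (i mod (q + 1))" for i
  proof -
    have "y ^ i = (y ^ (q + 1)) ^ (i div (q + 1)) * y ^ (i mod (q + 1))"
      unfolding power_mult[symmetric] power_add[symmetric] by (simp only: mult_div_mod_eq)
    then show ?thesis
      using assms(1) unfolding mu_iff by simp
  qed
  show ?thesis
    using *[of i] *[of j] assms(2) unfolding cong_def by simp
qed

lemma power_q_minus_1_in_mu: "x \<noteq> 0 \<Longrightarrow> x ^ (q - 1) \<in> mu"
  by (simp add: power_q_minus_1 mu_def cj_divide del: One_nat_def)

lemma mu_eq_power:
  assumes "t \<in> mu"
  obtains x where "x \<noteq> 0" "x ^ (q - 1) = t"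
proof (cases "t = 1")
  case True
  then show ?thesis using that[of 1] by simp
next
  case False
  \<comment> \<open>An explicit Hilbert 90: \<open>cj (1 + cj t) = 1 + t = t * (1 + cj t)\<close>
    because \<open>t * cj t = 1\<close>.\<close>
  let ?x = "1 + cj t"
  have "?x \<noteq> 0"
    using False by (metis add_eq_0_iff_eq cj_1 cj_cj)
  moreover have "cj ?x = t * ?x"
    using assms by (simp add: cj_add mu_def distrib_left)
  ultimately show ?thesis
    using that[of ?x] by (simp add: power_q_minus_1 del: One_nat_def)
qed

text \<open>All fibres of \<open>x \<mapsto> x ^ (q - 1)\<close> have the same size, which divides the odd number
  \<open>q\<^sup>2 - 1\<close>.\<close>
lemma sum_mu:
  "(\<Sum>x\<in>UNIV - {0}. F (x ^ (q - 1))) = (\<Sum>y\<in>mu. F y :: 'a)"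
proof -
  let ?S = "UNIV - {0::'a}" and ?h = "\<lambda>x::'a. x ^ (q - 1)"
  define n where "n = card {x\<in>?S. ?h x = 1}"
  have fib: "card {x\<in>?S. ?h x = y} = n" if "y \<in> mu" for y
  proof -
    obtain w where w: "w \<noteq> 0" "?h w = y"
      using mu_eq_power[OF \<open>y \<in> mu\<close>] by blast
    have "bij_betw ((*) w) {x\<in>?S. ?h x = 1} {x\<in>?S. ?h x = y}"
    proof (rule bij_betwI[where g = "\<lambda>x. x / w"])
      show "(*) w \<in> {x\<in>?S. ?h x = 1} \<rightarrow> {x\<in>?S. ?h x = y}"
        using w by (auto simp: power_mult_distrib simp del: One_nat_def)
      show "(\<lambda>x. x / w) \<in> {x\<in>?S. ?h x = y} \<rightarrow> {x\<in>?S. ?h x = 1}"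
        using w by (auto simp: power_divide simp del: One_nat_def)
    qed (use w in auto)
    then show ?thesis
      unfolding n_def by (rule bij_betw_same_card[symmetric])
  qed
  have sub: "?h ` ?S \<subseteq> mu"
    using power_q_minus_1_in_mu by auto
  have "card ?S = (\<Sum>y\<in>mu. card {x\<in>?S. ?h x = y})"
    using sum.group[of ?S mu ?h "\<lambda>_. 1::nat"] sub by simp
  also have "\<dots> = card mu * n"
    using fib by simp
  finally have "card mu * n = (q - 1) * (q + 1)"
    using card_minus_1 by (simp add: card_Diff_singleton)
  moreover have "odd ((q - 1) * (q + 1))"
    using even_q q_gt_1 by simp
  ultimately have "odd n"
    by (metis even_mult_iff)
  then have n1: "(of_nat n :: 'a) = 1"
    using two_eq_0 by (auto elim!: oddE)
  have "(\<Sum>x\<in>?S. F (?h x)) = (\<Sum>y\<in>mu. \<Sum>x\<in>{x\<in>?S. ?h x = y}. F (?h x))"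
    using sum.group[of ?S mu ?h "\<lambda>x. F (?h x)"] sub by simp
  also have "\<dots> = (\<Sum>y\<in>mu. \<Sum>x\<in>{x\<in>?S. ?h x = y}. F y)"
    by (intro sum.cong) auto
  also have "\<dots> = (\<Sum>y\<in>mu. F y)"
  proof (intro sum.cong refl)
    fix y assume "y \<in> mu"
    show "(\<Sum>x\<in>{x\<in>?S. ?h x = y}. F y) = F y"
      unfolding sum_constant fib[OF \<open>y \<in> mu\<close>] n1 by simp
  qed
  finally show ?thesis .
qed

end

section \<open>Artin--Schreier equations\<close>

lemma sum_lessThan_add:
  fixes g :: "nat \<Rightarrow> 'a::comm_monoid_add"
  shows "(\<Sum>i<m + n. g i) = (\<Sum>i<m. g i) + (\<Sum>i<n. g (m + i))"
  by (induction n) (simp_all add: add.assoc)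

context quadratic_extension
begin

lemma artin_schreier_telescope:
  "(\<Sum>i<n. (a\<^sup>2 + a) ^ 2 ^ i) = a ^ 2 ^ n + (a :: 'a)"
proof (induction n)
  case (Suc n)
  have "(a\<^sup>2 + a) ^ 2 ^ n = a ^ 2 ^ Suc n + a ^ 2 ^ n"
    by (simp add: frobenius flip: power_mult)
  then have "(\<Sum>i<Suc n. (a\<^sup>2 + a) ^ 2 ^ i) = a ^ 2 ^ Suc n + (a ^ 2 ^ n + (a ^ 2 ^ n + a))"
    unfolding sum.lessThan_Suc Suc by (simp only: ac_simps)
  then show ?case
    by simp
qed simp

lemma artin_schreier_eq_iff: "x\<^sup>2 + x = y\<^sup>2 + y \<longleftrightarrow> y = x \<or> y = x + (1::'a)"
proof -
  \<comment> \<open>This identity holds in every commutative ring; the correction term is a multiple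
    of 2.\<close>
  have "(x\<^sup>2 + x) - (y\<^sup>2 + y) = (y - x) * (y - (x + 1)) - 2 * (y\<^sup>2 - x * y)"
    by (simp add: power2_eq_square algebra_simps del: add_self add_self_left)
  then have "x\<^sup>2 + x = y\<^sup>2 + y \<longleftrightarrow> (y - x) * (y - (x + 1)) = 0"
    using two_eq_0 by (metis diff_zero eq_iff_diff_eq_0 mult_zero_left)
  then show ?thesis by simp
qed

text \<open>The image of \<open>a \<mapsto> a\<^sup>2 + a\<close> has \<open>q\<^sup>2 / 2\<close> elements, all of them roots of the absolute trace
  polynomial, which has degree \<open>q\<^sup>2 / 2\<close>.\<close>
lemma artin_schreier_solvable:
  assumes w: "cj w = w"
  shows "\<exists>a::'a. a\<^sup>2 + a = w"
proof -
  let ?A = "range (\<lambda>a::'a. a\<^sup>2 + a)"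
  let ?p = "\<Sum>i<2 * k. monom 1 (2 ^ i) :: 'a poly"
  have poly_p: "poly ?p x = (\<Sum>i<2 * k. x ^ 2 ^ i)" for x
    by (simp add: poly_sum poly_monom)
  have card: "CARD('a) = 2 * 2 ^ (2 * k - 1)"
    using k_pos by (simp add: card_K q_def power_mult[symmetric] mult.commute flip: power_Suc)
  have fib: "card {x::'a. x\<^sup>2 + x = y} = 2" if "y \<in> ?A" for y
  proof -
    from that obtain x where "y = x\<^sup>2 + x" by auto
    then have "{x::'a. x\<^sup>2 + x = y} = {x, x + 1}"
      using artin_schreier_eq_iff[of x] by (auto simp: eq_commute)
    then show ?thesis by simp
  qed
  have "CARD('a) = (\<Sum>y\<in>?A. card {x::'a. x\<^sup>2 + x = y})"
    using sum.group[of "UNIV::'a set" ?A "\<lambda>a. a\<^sup>2 + a" "\<lambda>_. 1::nat"] by simp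
  also have "\<dots> = card ?A * 2"
    using fib by simp
  finally have card_A: "card ?A = 2 ^ (2 * k - 1)"
    using card by simp
  have "coeff ?p 1 = (\<Sum>i<2 * k. if i = 0 then 1 else 0)"
    unfolding coeff_sum by (intro sum.cong) (auto simp: coeff_monom)
  then have "coeff ?p 1 = 1"
    using k_pos by (simp add: sum.delta)
  then have nz: "?p \<noteq> 0"
    by (metis coeff_0 one_neq_zero)
  have "?A \<subseteq> {x. poly ?p x = 0}"
  proof safe
    fix a :: 'a
    have "a ^ 2 ^ (2 * k) = a"
      using finite_field_power_card[of a] k_pos
      by (simp add: card_K q_def power_mult[symmetric] mult.commute)
    then show "poly ?p (a\<^sup>2 + a) = 0"
      unfolding poly_p artin_schreier_telescope by simp
  qed
  moreover have "card {x. poly ?p x = 0} \<le> card ?A"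
  proof -
    have "card {x. poly ?p x = 0} \<le> degree ?p"
      using nz by (rule card_poly_roots_bound)
    also have "\<dots> \<le> 2 ^ (2 * k - 1)"
      by (intro degree_sum_le) (auto intro!: order_trans[OF degree_monom_le] power_increasing)
    finally show ?thesis using card_A by simp
  qed
  ultimately have "?A = {x. poly ?p x = 0}"
    by (intro card_seteq) auto
  moreover have "poly ?p w = 0"
  proof -
    \<comment> \<open>As \<open>w\<close> is fixed by conjugation, the last \<open>k\<close> terms
      repeat the first \<open>k\<close> and cancel them.\<close>
    have "(\<Sum>i<k + k. w ^ 2 ^ i) = (\<Sum>i<k. w ^ 2 ^ i) + (\<Sum>i<k. w ^ 2 ^ (k + i))"
      by (rule sum_lessThan_add)
    also have "(\<Sum>i<k. w ^ 2 ^ (k + i)) = (\<Sum>i<k. (w ^ q) ^ 2 ^ i)"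
      by (simp add: power_add power_mult q_def)
    also have "w ^ q = w"
      using w by (simp add: cj_def)
    finally show ?thesis
      unfolding poly_p by (simp add: mult_2)
  qed
  ultimately have "w \<in> ?A" by blast
  then show ?thesis by (auto simp: eq_commute)
qed

text \<open>Conjugating yields another root of the same Artin--Schreier equation.\<close>

lemma artin_schreier_conj:
  assumes "cj (a\<^sup>2 + a) = a\<^sup>2 + a"
  shows "cj a = a \<or> cj a = a + 1"
  using assms artin_schreier_eq_iff[of a "cj a"] by (simp add: cj_add cj_power eq_commute)

end

section \<open>Reduction to the unit circle\<close>

locale projective_map = quadratic_extension k q K
  for k q :: nat and K :: "'a::{field,finite} itself" +
  fixes l Q :: nat and b c :: 'a
  assumes l_pos: "l > 0" and Q_def: "Q = 2 ^ l" and coprime_Q_q: "coprime (Q + 1) (q + 1)"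
begin

lemma Q_gt_1: "Q > 1"
  using l_pos unfolding Q_def by (intro one_less_power) auto

lemma power_Q_add: "(x + y) ^ Q = x ^ Q + (y ^ Q :: 'a)"
  unfolding Q_def by (rule frobenius)

lemma power_Q_inj: "x ^ Q = y ^ Q \<Longrightarrow> x = (y::'a)"
  unfolding Q_def by (rule frobenius_inj)

lemma power_Q_surj: "\<exists>x::'a. x ^ Q = y"
  unfolding Q_def by (rule frobenius_surj)

definition D :: "'a \<Rightarrow> 'a" where
  "D y = 1 + b * y ^ Q + c * y"

text \<open>The reciprocal polynomial of \<open>D\<close> with conjugated coefficients;
  \<open>N_eq\<close> relates the two on \<open>mu\<close>.\<close>

definition N :: "'a \<Rightarrow> 'a" where
  "N y = y ^ (Q + 1) + cj c * y ^ Q + cj b * y"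

definition e :: 'a where
  "e = 1 + b * cj b + c * cj c"

text \<open>Absence of poles and injectivity of \<open>N / D\<close> on \<open>mu\<close>, the
  latter cross-multiplied to avoid division.\<close>

definition mu_injective :: bool where
  "mu_injective \<longleftrightarrow> (\<forall>y\<in>mu. D y \<noteq> 0) \<and>
     (\<forall>y\<in>mu. \<forall>z\<in>mu. N y * D z = N z * D y \<longrightarrow> y = z)"

lemma cj_e [simp]: "cj e = e"
  by (simp add: e_def cj_simps mult.commute)

lemma N_eq: "y \<in> mu \<Longrightarrow> N y = y ^ (Q + 1) * cj (D y)"
  by (simp add: N_def D_def cj_simps mu_cj mu_nonzero power_divide distrib_left)

context
  fixes u v :: nat and A f :: "'a poly"
  assumes u: "[u * (Q + 1) = 1] (mod (q + 1))"
    and v: "[v * (Q + 1) = Q] (mod (q + 1))"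
    and A: "A = 1 + monom b v + monom c u"
    and f: "f = monom 1 1 * pcompose A (monom 1 (q - 1))"
begin

text \<open>Multiply \<open>v\<close> by \<open>u * (Q + 1)\<close>, which is 1 modulo
  \<open>q + 1\<close>. Hence \<open>t ^ v = (t ^ u) ^ Q\<close> on \<open>mu\<close>, which turns
  \<open>A\<close> into \<open>D\<close>.\<close>

lemma v_cong: "[v = u * Q] (mod (q + 1))"
proof -
  have "[v * 1 = v * (u * (Q + 1))] (mod (q + 1))"
    by (rule cong_scalar_left[OF cong_sym[OF u]])
  also have "v * (u * (Q + 1)) = u * (v * (Q + 1))"
    by (simp add: algebra_simps)
  also have "[u * (v * (Q + 1)) = u * Q] (mod (q + 1))"
    by (rule cong_scalar_left[OF v])
  finally show ?thesis by simp
qed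

lemma mu_power_u: "t \<in> mu \<Longrightarrow> (t ^ u) ^ (Q + 1) = t"
  using mu_power_cong[OF _ u, of t] by (simp only: power_mult power_one_right)

lemma mu_power_Q1_inj: "y \<in> mu \<Longrightarrow> (y ^ (Q + 1)) ^ u = y"
  using mu_power_u[of y] by (simp only: power_mult[symmetric] mult.commute)

lemma poly_f: "poly f x = x * D ((x ^ (q - 1)) ^ u)"
proof (cases "x = 0")
  case False
  have eq: "(x ^ (q - 1)) ^ v = ((x ^ (q - 1)) ^ u) ^ Q"
    using mu_power_cong[OF power_q_minus_1_in_mu[OF False] v_cong] by (simp only: power_mult)
  show ?thesis
    by (simp add: eq f A poly_pcompose poly_monom D_def del: One_nat_def)
qed (simp add: f poly_monom)

lemma poly_f_power:
  assumes "x \<noteq> 0" "y = (x ^ (q - 1)) ^ u" "D y \<noteq> 0"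
  shows "poly f x ^ (q - 1) = N y / D y"
proof -
  have t: "x ^ (q - 1) \<in> mu"
    using assms(1) by (rule power_q_minus_1_in_mu)
  then have y: "y \<in> mu"
    using assms(2) mu_power by simp
  have "poly f x ^ (q - 1) = x ^ (q - 1) * D y ^ (q - 1)"
    by (simp only: poly_f assms(2) power_mult_distrib)
  also have "\<dots> = y ^ (Q + 1) * (cj (D y) / D y)"
    using assms(2,3) mu_power_u[OF t] power_q_minus_1 by simp
  finally show ?thesis
    using N_eq[OF y] by simp
qed

lemma ex_preimage:
  assumes "y \<in> mu"
  obtains x where "x \<noteq> 0" "(x ^ (q - 1)) ^ u = y"
proof -
  obtain x where "x \<noteq> 0" "x ^ (q - 1) = y ^ (Q + 1)"
    using mu_eq_power[OF mu_power[OF assms]] by blast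
  then show ?thesis
    using that mu_power_Q1_inj[OF assms] by metis
qed

text \<open>A fibre of \<open>x ^ (q - 1)\<close> on nonzero elements is a punctured line over the
  field with \<open>q\<close> elements. There \<open>f\<close> is multiplication by a constant value
  of \<open>D\<close>, and on the set of lines it acts as \<open>N / D\<close> by
  \<open>poly_f_power\<close>. So \<open>f\<close> is injective iff no line collapses and no two
  lines collide.\<close>

lemma permutes_iff_mu_injective: "permutes_field f \<longleftrightarrow> mu_injective"
proof
  assume "permutes_field f"
  then have inj: "inj (poly f)"
    by (simp add: permutes_field_def bij_def)
  have D: "D y \<noteq> 0" if "y \<in> mu" for y
  proof
    assume "D y = 0"
    obtain x where x: "x \<noteq> 0" "(x ^ (q - 1)) ^ u = y"
      using ex_preimage[OF \<open>y \<in> mu\<close>] by blast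
    then have "poly f x = poly f 0"
      using \<open>D y = 0\<close> by (simp add: poly_f del: One_nat_def)
    with inj x show False by (auto dest: injD)
  qed
  moreover have "y = z" if yz: "y \<in> mu" "z \<in> mu" and eq: "N y * D z = N z * D y" for y z
  proof -
    obtain x1 where x1: "x1 \<noteq> 0" "(x1 ^ (q - 1)) ^ u = y"
      using ex_preimage[OF yz(1)] by blast
    obtain x2 where x2: "x2 \<noteq> 0" "(x2 ^ (q - 1)) ^ u = z"
      using ex_preimage[OF yz(2)] by blast
    \<comment> \<open>This ratio has \<open>(q - 1)\<close>-st power 1, so scaling by it commutes
      with \<open>f\<close>.\<close>
    define s where "s = poly f x1 / poly f x2"
    have nz: "poly f x1 \<noteq> 0" "poly f x2 \<noteq> 0"
      using D yz x1 x2 by (simp_all add: poly_f del: One_nat_def)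
    have "N y / D y = N z / D z"
      using eq D yz by (simp add: field_simps)
    moreover have "N z \<noteq> 0"
      using D yz mu_nonzero by (simp add: N_eq)
    ultimately have s: "s ^ (q - 1) = 1" "s \<noteq> 0"
      using poly_f_power[OF x1(1) x1(2)[symmetric]] poly_f_power[OF x2(1) x2(2)[symmetric]] D yz nz
      by (simp_all add: s_def power_divide del: One_nat_def)
    have "(s * x2) ^ (q - 1) = x2 ^ (q - 1)"
      using s by (simp add: power_mult_distrib del: One_nat_def)
    then have "poly f (s * x2) = s * poly f x2"
      by (simp add: poly_f del: One_nat_def)
    also have "\<dots> = poly f x1"
      using nz by (simp add: s_def)
    finally have "s * x2 = x1"
      using inj by (auto dest: injD)
    with \<open>(s * x2) ^ (q - 1) = x2 ^ (q - 1)\<close> x1 x2 show ?thesis by simp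
  qed
  ultimately show mu_injective
    unfolding mu_injective_def by blast
next
  assume "mu_injective"
  then have D0: "\<And>y. y \<in> mu \<Longrightarrow> D y \<noteq> 0"
    and inj0: "\<And>y z. y \<in> mu \<Longrightarrow> z \<in> mu \<Longrightarrow> N y * D z = N z * D y \<Longrightarrow> y = z"
    unfolding mu_injective_def by blast+
  have mu: "(x ^ (q - 1)) ^ u \<in> mu" if "x \<noteq> 0" for x
    by (rule mu_power[OF power_q_minus_1_in_mu[OF that]])
  have D: "D ((x ^ (q - 1)) ^ u) \<noteq> 0" if "x \<noteq> 0" for x
    using D0[OF mu[OF that]] .
  have zero: "poly f x = 0 \<longleftrightarrow> x = 0" for x
    using D[of x] by (simp only: poly_f mult_eq_0_iff) blast
  have "inj (poly f)"
  proof (rule injI)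
    fix x1 x2 assume eq: "poly f x1 = poly f x2"
    show "x1 = x2"
    proof (cases "x1 = 0 \<or> x2 = 0")
      case True
      then have "poly f x1 = 0 \<or> poly f x2 = 0"
        unfolding zero .
      then have "poly f x1 = 0" "poly f x2 = 0"
        using eq by simp_all
      then show ?thesis
        unfolding zero by simp
    next
      case False
      then have nz: "x1 \<noteq> 0" "x2 \<noteq> 0"
        by simp_all
      define y where "y = (x1 ^ (q - 1)) ^ u"
      define z where "z = (x2 ^ (q - 1)) ^ u"
      have yz: "y \<in> mu" "z \<in> mu" "D y \<noteq> 0" "D z \<noteq> 0"
        unfolding y_def z_def by (rule mu D nz)+
      have "N y / D y = N z / D z"
        using poly_f_power[OF nz(1) y_def yz(3)] poly_f_power[OF nz(2) z_def yz(4)] eq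
        by (simp only:)
      then have "N y * D z = N z * D y"
        using yz by (simp add: frac_eq_eq)
      then have "y = z"
        by (rule inj0[OF yz(1,2)])
      then show ?thesis
        using eq yz(4) by (simp only: poly_f y_def[symmetric] z_def[symmetric]) simp
    qed
  qed
  then show "permutes_field f"
    unfolding permutes_field_def by (intro bijI finite_UNIV_inj_surj) auto
qed

end

end

section \<open>Ramification points\<close>

context projective_map
begin

text \<open>A root \<open>r\<close> of \<open>b X\<^bsup>2Q\<^esup> + e X\<^bsup>Q\<^esup> + b\<^sup>q\<close>, the numerator of the derivative of \<open>N / D\<close>, is a
  \<open>Q\<close>-fold point of the fibre through it. The remaining point of that fibre again lies on
  the unit circle, so injectivity forces it to be \<open>r\<close> itself.\<close>
lemma ramified_point_on_mu:
  assumes inj: mu_injective and r: "r \<in> mu"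
    and root: "b * (r ^ Q)\<^sup>2 + e * r ^ Q + cj b = 0"
  shows "r ^ Q = cj b + r ^ Q * r * c"
proof -
  define p where "p = r ^ Q"
  define t where "t = N r / D r"
  have D: "D r \<noteq> 0"
    using inj r unfolding mu_injective_def by blast
  have p: "p \<in> mu" "p \<noteq> 0" "cj p = 1 / p"
    unfolding p_def using mu_power[OF r, of Q] by (simp_all add: mu_cj mu_nonzero r)
  have t_mu: "t \<in> mu"
    using D r mu_nonzero[OF r] mu_cj[OF r]
    by (simp add: t_def N_eq r mu_def cj_simps power_divide)
  then have t: "t \<noteq> 0" "cj t = 1 / t"
    by (simp_all add: mu_nonzero mu_cj)
  \<comment> \<open>The terms containing \<open>r\<close> itself cancel, leaving the ramification
    quadratic at \<open>p = r ^ Q\<close>.\<close>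
  have "(p + cj b) * D r + c * N r = b * p\<^sup>2 + e * p + cj b"
    unfolding D_def N_def e_def power_add power_one_right p_def[symmetric]
    by (simp add: algebra_simps power2_eq_square)
  also have "\<dots> = 0"
    using root unfolding p_def .
  finally have "(p + cj b) * D r = c * N r"
    by (simp only: add_eq_0_iff_eq)
  then have tc: "t * c = p + cj b"
    using D by (simp add: t_def field_simps)
  then have "cj (t * c) = cj (p + cj b)"
    by simp
  then have "cj c / t = 1 / p + b"
    by (simp add: cj_simps p t)
  then have "cj c = t / p + t * b"
    using t(1) by (simp add: nonzero_divide_eq_eq distrib_left ac_simps)
  then have tb: "cj c + t * b = t / p"
    by simp
  have s: "t / p \<in> mu"
    using t_mu p(1) by (rule mu_divide)
  \<comment> \<open>The fibre over \<open>t\<close> is cut out by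
    \<open>N y + t * D y = (y + r) ^ Q * (y + t / p)\<close>, so \<open>t / p\<close> is its
    remaining point.\<close>
  have "N (t / p) + t * D (t / p)
      = (t / p) ^ Q * (t / p + (cj c + t * b)) + (t * c + cj b) * (t / p) + t"
    by (simp add: N_def D_def distrib_left distrib_right ac_simps)
  also have "\<dots> = (p + (cj b + cj b)) * (t / p) + t"
    unfolding tb tc by (simp add: ac_simps)
  also have "\<dots> = 0"
    using p(2) by simp
  finally have "N (t / p) = t * D (t / p)"
    by (simp add: add_eq_0_iff_eq)
  then have "N (t / p) * D r = N r * D (t / p)"
    using D by (simp add: t_def)
  then have "t / p = r"
    using inj s r unfolding mu_injective_def by blast
  then have "t = p * r"
    using p(2) by (simp add: field_simps)
  with tc have "p * r * c = p + cj b"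
    by simp
  then show ?thesis
    unfolding p_def[symmetric] by (simp add: ac_simps)
qed

text \<open>For \<open>e = 0\<close> a zero of \<open>D\<close> on \<open>mu\<close> appears:
  \<open>1 / c\<close> if \<open>b = 0\<close>, and otherwise the double ramification point.\<close>

lemma mu_injective_imp_e_nonzero:
  assumes inj: mu_injective
  shows "e \<noteq> 0"
proof
  assume e: "e = 0"
  have D: "D y \<noteq> 0" if "y \<in> mu" for y
    using inj that unfolding mu_injective_def by blast
  show False
  proof (cases "b = 0")
    case True
    with e have "1 + c * cj c = 0"
      unfolding e_def by simp
    then have "c * cj c = 1"
      by (simp only: add_eq_0_iff_eq)
    then have "c \<noteq> 0" "1 / c \<in> mu"
      by (auto simp: mu_def cj_divide)
    moreover have "D (1 / c) = 0"
      unfolding D_def using True \<open>c \<noteq> 0\<close> by simp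
    ultimately show False
      using D by blast
  next
    case False
    obtain bt where bt: "bt ^ Q = b"
      using power_Q_surj by blast
    with False have bt0: "bt \<noteq> 0"
      using Q_gt_1 by auto
    \<comment> \<open>Squaring is bijective, and \<open>r ^ Q\<close> becomes the double root of
      \<open>b X\<^sup>2 + cj b\<close>.\<close>
    obtain r where r: "r\<^sup>2 = cj bt / bt"
      using frobenius_surj[of 1 "cj bt / bt"] by auto
    have "(r * cj r) ^ 2 ^ 1 = 1 ^ 2 ^ 1"
      using bt0 by (simp add: power_mult_distrib cj_simps r flip: cj_power)
    then have r_mu: "r \<in> mu"
      unfolding mu_def using frobenius_inj by blast
    have r0: "r \<noteq> 0"
      using r_mu by (rule mu_nonzero)
    have "(r ^ Q)\<^sup>2 = (r\<^sup>2) ^ Q"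
      by (simp add: power_mult[symmetric] mult.commute)
    also have "\<dots> = cj b / b"
      unfolding r power_divide bt by (simp add: bt flip: cj_power)
    finally have rQ: "b * (r ^ Q)\<^sup>2 = cj b"
      using False by simp
    then have "r ^ Q = b * (r ^ Q)\<^sup>2 + r ^ Q * r * c"
      using ramified_point_on_mu[OF inj r_mu] e by simp
    also have "\<dots> = r ^ Q * (b * r ^ Q + c * r)"
      by (simp add: power2_eq_square algebra_simps)
    finally have "b * r ^ Q + c * r = 1"
      using r0 by simp
    then have "D r = 0"
      by (simp add: D_def add.assoc)
    with D r_mu show False by blast
  qed
qed

end

text \<open>With \<open>bt\<close> and \<open>ep\<close> the \<open>Q\<close>-th roots of
  \<open>b\<close> and \<open>e\<close>, the points \<open>r\<close> and \<open>r'\<close> are the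
  roots of \<open>bt X\<^sup>2 + ep X + cj bt\<close>. Substituting \<open>X = ep * a / bt\<close>
  normalises this quadratic to the Artin--Schreier equation for \<open>a\<close>.\<close>

locale ramification = projective_map k q K l Q b c
  for k q :: nat and K :: "'a::{field,finite} itself" and l Q b c +
  fixes bt ep a r r' :: 'a
  assumes bt: "bt ^ Q = b" and ep: "ep ^ Q = e"
    and bt_nonzero: "bt \<noteq> 0" and ep_nonzero: "ep \<noteq> 0"
    and a: "a\<^sup>2 + a = bt * cj bt / ep\<^sup>2"
    and r_def: "r = ep * a / bt" and r'_def: "r' = ep * (a + 1) / bt"
begin

lemma cj_ep [simp]: "cj ep = ep"
  by (rule power_Q_inj) (simp add: ep flip: cj_power)

lemma b_nonzero: "b \<noteq> 0" and e_nonzero: "e \<noteq> 0"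
  using bt ep bt_nonzero ep_nonzero by auto

lemma a_mult: "a * (a + 1) = bt * cj bt / ep\<^sup>2"
  using a by (simp add: power2_eq_square distrib_left)

lemma a_nonzero: "a \<noteq> 0" and a1_nonzero: "a + 1 \<noteq> 0"
  using a_mult bt_nonzero ep_nonzero by auto

lemma r_nonzero: "r \<noteq> 0" and r'_nonzero: "r' \<noteq> 0"
  using a_nonzero a1_nonzero bt_nonzero ep_nonzero by (simp_all add: r_def r'_def)

lemma r_add: "r + r' = ep / bt"
  by (simp add: r_def r'_def distrib_left add_divide_distrib)

lemma r_neq: "r \<noteq> r'"
  using r_add bt_nonzero ep_nonzero by auto

lemma r_mult: "r * r' = cj bt / bt"
proof -
  have "r * r' = ep\<^sup>2 * (a * (a + 1)) / bt\<^sup>2"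
    by (simp add: r_def r'_def power2_eq_square)
  then show ?thesis
    using bt_nonzero ep_nonzero by (simp add: a_mult power2_eq_square)
qed

lemma rQ_add: "r ^ Q + r' ^ Q = e / b"
  using arg_cong[OF r_add, of "\<lambda>x. x ^ Q"] by (simp add: power_Q_add power_divide bt ep)

lemma rQ_mult: "r ^ Q * r' ^ Q = cj b / b"
  using arg_cong[OF r_mult, of "\<lambda>x. x ^ Q"]
  by (simp add: power_mult_distrib power_divide bt flip: cj_power)

lemma rQ_root: "b * (r ^ Q)\<^sup>2 + e * r ^ Q + cj b = 0"
  and r'Q_root: "b * (r' ^ Q)\<^sup>2 + e * r' ^ Q + cj b = 0"
proof -
  have "e = b * (r ^ Q + r' ^ Q)" "cj b = b * (r ^ Q * r' ^ Q)"
    using b_nonzero by (simp_all add: rQ_add rQ_mult)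
  then show "b * (r ^ Q)\<^sup>2 + e * r ^ Q + cj b = 0" "b * (r' ^ Q)\<^sup>2 + e * r' ^ Q + cj b = 0"
    by (simp_all add: power2_eq_square algebra_simps)
qed

lemma a_conj: "cj a = a \<or> cj a = a + 1"
  by (rule artin_schreier_conj) (simp add: a cj_simps mult.commute)

lemma condition2_iff: "c ^ Q = e ^ (Q - 1) * b \<longleftrightarrow> c = ep ^ (Q - 1) * bt"
proof -
  have "e ^ (Q - 1) * b = (ep ^ (Q - 1) * bt) ^ Q"
    by (simp add: bt ep power_mult_distrib power_mult[symmetric] mult.commute del: One_nat_def)
      (simp add: ep power_mult del: One_nat_def)
  then show ?thesis
    using power_Q_inj by metis
qed

text \<open>The symmetric relation at which both proofs of condition (2) arrive.\<close>

lemma condition2I: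
  assumes "c * (r + r') = b * (r ^ Q + r' ^ Q)"
  shows "c = ep ^ (Q - 1) * bt"
proof -
  have "c * ep = ep ^ Q * bt"
    using assms bt_nonzero b_nonzero by (simp add: r_add rQ_add ep field_simps)
  also have "ep ^ Q = ep ^ (Q - 1) * ep"
    using Q_gt_1 by (intro power_minus_mult[symmetric]) simp
  finally show ?thesis
    using ep_nonzero by simp
qed

text \<open>Conjugation fixes \<open>ep\<close> and \<open>a\<close>, so \<open>cj r * r'\<close> is
  \<open>ep\<^sup>2 * (a * (a + 1)) / (bt * cj bt) = 1\<close>.\<close>

lemma conj_split:
  assumes "cj a = a"
  shows "cj r = 1 / r'" "cj r' = 1 / r"
proof -
  have "cj r * r' = ep\<^sup>2 * (a * (a + 1)) / (bt * cj bt)" "cj r' * r = ep\<^sup>2 * (a * (a + 1)) / (bt * cj bt)"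
    by (simp_all add: r_def r'_def cj_simps assms power2_eq_square ac_simps)
  then have "cj r * r' = 1" "cj r' * r = 1"
    using bt_nonzero ep_nonzero by (simp_all add: a_mult)
  then show "cj r = 1 / r'" "cj r' = 1 / r"
    using r_nonzero r'_nonzero by (simp_all add: field_simps)
qed

text \<open>Conjugation now swaps \<open>a\<close> and \<open>a + 1\<close>, so the same quotient is
  the norm of \<open>r\<close> and of \<open>r'\<close>.\<close>

lemma conj_nonsplit:
  assumes "cj a = a + 1"
  shows "r \<in> mu" "r' \<in> mu"
proof -
  have "r * cj r = ep\<^sup>2 * (a * (a + 1)) / (bt * cj bt)" "r' * cj r' = ep\<^sup>2 * (a * (a + 1)) / (bt * cj bt)"
    by (simp_all add: r_def r'_def cj_simps assms power2_eq_square ac_simps)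
  then show "r \<in> mu" "r' \<in> mu"
    using bt_nonzero ep_nonzero by (simp_all add: a_mult mu_def)
qed

text \<open>Both ramification points lie on \<open>mu\<close>; \<open>ramified_point_on_mu\<close>
  gives one relation for each, and their sum is the relation in \<open>condition2I\<close>.\<close>

lemma condition2_nonsplit:
  assumes inj: mu_injective and "cj a = a + 1"
  shows "c = ep ^ (Q - 1) * bt"
proof -
  have *: "1 = b * r' ^ Q + r * c" "1 = b * r ^ Q + r' * c"
  proof -
    have cb: "cj b = b * (r ^ Q * r' ^ Q)"
      using b_nonzero by (simp add: rQ_mult)
    have "r ^ Q * 1 = r ^ Q * (b * r' ^ Q + r * c)"
      using ramified_point_on_mu[OF inj conj_nonsplit(1)[OF assms(2)] rQ_root] cb
      by (simp add: algebra_simps)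
    then show "1 = b * r' ^ Q + r * c"
      using r_nonzero by simp
    have "r' ^ Q * 1 = r' ^ Q * (b * r ^ Q + r' * c)"
      using ramified_point_on_mu[OF inj conj_nonsplit(2)[OF assms(2)] r'Q_root] cb
      by (simp add: algebra_simps)
    then show "1 = b * r ^ Q + r' * c"
      using r'_nonzero by simp
  qed
  have "c * (r + r') + b * (r ^ Q + r' ^ Q) = (b * r' ^ Q + r * c) + (b * r ^ Q + r' * c)"
    by (simp add: algebra_simps)
  also have "\<dots> = 0"
    unfolding *[symmetric] by simp
  finally show ?thesis
    by (intro condition2I) (simp only: add_eq_0_iff_eq)
qed

end

section \<open>The totally ramified case\<close>

locale condition2 = ramification +
  assumes c_eq: "c = ep ^ (Q - 1) * bt"
begin

lemma ep_power_Q: "ep ^ (Q - 1) * ep = e"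
  using Q_gt_1 by (simp only: ep[symmetric]) (intro power_minus_mult, simp)

text \<open>Condition (2) makes \<open>1 / e\<close> and \<open>a ^ Q + a\<close> roots of the same
  equation \<open>X\<^sup>2 + X = w ^ Q + w\<close>.\<close>

lemma inverse_e_cases:
  obtains "1 / e = a ^ Q + a + 1" | "1 / e = a ^ Q + a"
proof -
  define w where "w = a\<^sup>2 + a"
  have w: "bt * cj bt = ep\<^sup>2 * w"
    using ep_nonzero by (simp add: w_def a)
  have ep2Q: "(ep ^ 2) ^ Q = e\<^sup>2"
    by (simp add: ep[symmetric] power_mult[symmetric] mult.commute)
  have "b * cj b = (bt * cj bt) ^ Q"
    by (simp add: bt[symmetric] power_mult_distrib cj_power)
  also have "\<dots> = e\<^sup>2 * w ^ Q"
    unfolding w power_mult_distrib ep2Q ..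
  finally have b2: "b * cj b = e\<^sup>2 * w ^ Q" .
  have "c * cj c = (ep ^ (Q - 1))\<^sup>2 * (bt * cj bt)"
    by (simp add: c_eq cj_simps power2_eq_square ac_simps del: One_nat_def)
  also have "\<dots> = (ep ^ (Q - 1) * ep)\<^sup>2 * w"
    unfolding w power_mult_distrib by (simp only: ac_simps)
  finally have c2: "c * cj c = e\<^sup>2 * w"
    unfolding ep_power_Q .
  have e: "e = 1 + e\<^sup>2 * w ^ Q + e\<^sup>2 * w"
    using b2 c2 unfolding e_def by simp
  have "(1 / e)\<^sup>2 + 1 / e = (1 + e) / e\<^sup>2"
    using e_nonzero by (simp add: power2_eq_square add_divide_distrib)
  also have "1 + e = e\<^sup>2 * w ^ Q + e\<^sup>2 * w"
    by (subst e) (simp add: add.assoc)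
  also have "(e\<^sup>2 * w ^ Q + e\<^sup>2 * w) / e\<^sup>2 = w ^ Q + w"
    using e_nonzero by (simp add: add_divide_distrib)
  also have "w ^ Q = (a ^ Q)\<^sup>2 + a ^ Q"
    by (simp add: w_def power_Q_add power_mult[symmetric] mult.commute)
  also have "(a ^ Q)\<^sup>2 + a ^ Q + w = (a ^ Q + a)\<^sup>2 + (a ^ Q + a)"
    by (simp add: w_def power2_add ac_simps)
  finally show ?thesis
    using artin_schreier_eq_iff[of "a ^ Q + a" "1 / e"] that by auto
qed

section \<open>Normal forms of \<open>D\<close> and \<open>N\<close> in terms of
  \<open>y + r\<close> and \<open>y + r'\<close>\<close>

definition \<kappa> :: 'a where
  "\<kappa> = b * bt / ep"

lemma kappa_nonzero: "\<kappa> \<noteq> 0"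
  using b_nonzero bt_nonzero ep_nonzero by (simp add: \<kappa>_def)

lemma kappa_add: "\<kappa> * (r + r') = b"
  using bt_nonzero ep_nonzero by (simp add: \<kappa>_def r_add)

lemma kappa_addQ: "\<kappa> * (r ^ Q + r' ^ Q) = c"
proof -
  have "\<kappa> * (r ^ Q + r' ^ Q) = e * bt / ep"
    using b_nonzero by (simp add: \<kappa>_def rQ_add)
  then show ?thesis
    using ep_nonzero ep_power_Q[symmetric] by (simp add: c_eq del: One_nat_def)
qed

lemma rQ: "r ^ Q = e * a ^ Q / b" and r'Q: "r' ^ Q = e * (a ^ Q + 1) / b"
  by (simp_all add: r_def r'_def power_divide power_mult_distrib power_Q_add bt ep)

text \<open>The constant term in \<open>D_parallel\<close>: there each \<open>Q\<close>-th power is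
  paired with its own base, in the crossed form with the other one. It equals 1 iff
  \<open>1 / e = a ^ Q + a + 1\<close>.\<close>

lemma kappa_parallel:
  "\<kappa> * (r ^ Q * r + r' ^ Q * r') = e * (a ^ Q + a + 1)"
proof -
  have "\<kappa> * (r ^ Q * r + r' ^ Q * r') = e * (a ^ Q * a + (a ^ Q + 1) * (a + 1))"
    using b_nonzero bt_nonzero ep_nonzero
    unfolding rQ r'Q by (simp add: \<kappa>_def r_def r'_def field_simps)
  then show ?thesis
    by (simp add: distrib_left distrib_right ac_simps)
qed

lemma kappa_crossed:
  "\<kappa> * (r ^ Q * r' + r' ^ Q * r) = e * (a ^ Q + a)"
proof -
  have "\<kappa> * (r ^ Q * r' + r' ^ Q * r) = e * (a ^ Q * (a + 1) + (a ^ Q + 1) * a)"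
    using b_nonzero bt_nonzero ep_nonzero
    unfolding rQ r'Q by (simp add: \<kappa>_def r_def r'_def field_simps)
  then show ?thesis
    by (simp add: distrib_left distrib_right ac_simps)
qed

text \<open>The two terms \<open>y ^ (Q + 1)\<close> cancel; the other coefficients, scaled by
  \<open>\<kappa>\<close>, are \<open>b\<close>, \<open>c\<close> and 1.\<close>

lemma D_parallel:
  assumes "1 / e = a ^ Q + a + 1"
  shows "D y = \<kappa> * ((y + r) ^ (Q + 1) + (y + r') ^ (Q + 1))"
proof -
  have eq: "(y + r) ^ (Q + 1) + (y + r') ^ (Q + 1)
      = (r ^ Q * r + r' ^ Q * r') + (r + r') * y ^ Q + (r ^ Q + r' ^ Q) * y"
    by (simp add: power_Q_add distrib_left distrib_right ac_simps)
  have "\<kappa> * ((y + r) ^ (Q + 1) + (y + r') ^ (Q + 1))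
      = \<kappa> * (r ^ Q * r + r' ^ Q * r') + \<kappa> * (r + r') * y ^ Q + \<kappa> * (r ^ Q + r' ^ Q) * y"
    unfolding eq by (simp add: distrib_left distrib_right mult.assoc)
  also have "\<dots> = D y"
    unfolding kappa_add kappa_addQ kappa_parallel D_def
    using e_nonzero by (simp add: assms[symmetric])
  finally show ?thesis ..
qed

lemma D_crossed:
  assumes "1 / e = a ^ Q + a"
  shows "D y = \<kappa> * ((y + r) ^ Q * (y + r') + (y + r) * (y + r') ^ Q)"
proof -
  have eq: "(y + r) ^ Q * (y + r') + (y + r) * (y + r') ^ Q
      = (r ^ Q * r' + r' ^ Q * r) + (r + r') * y ^ Q + (r ^ Q + r' ^ Q) * y"
    by (simp add: power_Q_add distrib_left distrib_right ac_simps)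
  have "\<kappa> * ((y + r) ^ Q * (y + r') + (y + r) * (y + r') ^ Q)
      = \<kappa> * (r ^ Q * r' + r' ^ Q * r) + \<kappa> * (r + r') * y ^ Q + \<kappa> * (r ^ Q + r' ^ Q) * y"
    unfolding eq by (simp add: distrib_left distrib_right mult.assoc)
  also have "\<dots> = D y"
    unfolding kappa_add kappa_addQ kappa_crossed D_def
    using e_nonzero by (simp add: assms[symmetric])
  finally show ?thesis ..
qed

text \<open>Up to nonzero scalars, conjugation exchanges the two factors here and preserves each in
  \<open>cj_add_nonsplit\<close>.\<close>

lemma cj_add_split:
  assumes "cj a = a" "y \<in> mu"
  shows "cj (y + r) = (y + r') / (y * r')" "cj (y + r') = (y + r) / (y * r)"
  using conj_split[OF assms(1)] mu_cj[OF assms(2)] mu_nonzero[OF assms(2)] r_nonzero r'_nonzero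
  by (simp_all add: cj_add add_divide_distrib)

lemma cj_add_nonsplit:
  assumes "cj a = a + 1" "y \<in> mu"
  shows "cj (y + r) = (y + r) / (y * r)" "cj (y + r') = (y + r') / (y * r')"
  using conj_nonsplit[OF assms(1)] mu_cj mu_nonzero assms(2)
  by (simp_all add: cj_add add_divide_distrib)

lemma conj_sum_cancel:
  "t \<noteq> 0 \<Longrightarrow> t * (f * (p / (t * g) + s / (t * h))) = f / g * p + f / h * (s :: 'a)"
  by (simp add: distrib_left)

text \<open>Conjugate \<open>D_parallel\<close>. Whether the two factors are exchanged or preserved
  does not matter, since the sum is symmetric in them.\<close>

lemma N_parallel:
  assumes "1 / e = a ^ Q + a + 1" and y: "y \<in> mu"
  shows "N y = cj \<kappa> / r ^ (Q + 1) * (y + r) ^ (Q + 1) + cj \<kappa> / r' ^ (Q + 1) * (y + r') ^ (Q + 1)"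
proof -
  have eq: "cj ((y + r) ^ (Q + 1)) + cj ((y + r') ^ (Q + 1))
      = (y + r) ^ (Q + 1) / (y ^ (Q + 1) * r ^ (Q + 1))
        + (y + r') ^ (Q + 1) / (y ^ (Q + 1) * r' ^ (Q + 1))"
    using a_conj
  proof
    assume "cj a = a"
    then show ?thesis
      using cj_add_split[OF _ y]
      by (simp only: cj_power power_divide power_mult_distrib) (simp only: add.commute)
  next
    assume "cj a = a + 1"
    then show ?thesis
      using cj_add_nonsplit[OF _ y] by (simp only: cj_power power_divide power_mult_distrib)
  qed
  have "N y = y ^ (Q + 1) * (cj \<kappa> * (cj ((y + r) ^ (Q + 1)) + cj ((y + r') ^ (Q + 1))))"
    unfolding N_eq[OF y] D_parallel[OF assms(1)] by (simp only: cj_mult cj_add)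
  then show ?thesis
    unfolding eq using mu_nonzero[OF y] by (subst (asm) conj_sum_cancel) (simp_all del: power_Suc)
qed

lemma N_crossed:
  assumes "1 / e = a ^ Q + a" and split: "cj a = a" and y: "y \<in> mu"
  shows "N y = cj \<kappa> / (r ^ Q * r') * ((y + r) ^ Q * (y + r'))
    + cj \<kappa> / (r * r' ^ Q) * ((y + r) * (y + r') ^ Q)"
proof -
  have eq: "cj ((y + r) ^ Q * (y + r') + (y + r) * (y + r') ^ Q)
     = ((y + r) ^ Q * (y + r')) / (y ^ (Q + 1) * (r ^ Q * r'))
       + ((y + r) * (y + r') ^ Q) / (y ^ (Q + 1) * (r * r' ^ Q))"
    unfolding cj_add[of "_ * _"] cj_mult cj_power cj_add_split[OF split y]
    by (simp add: power_divide power_mult_distrib ac_simps)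
  show ?thesis
    unfolding N_eq[OF y] D_crossed[OF assms(1)] cj_mult[of \<kappa>] eq
    using mu_nonzero[OF y] by (intro conj_sum_cancel) simp
qed

text \<open>As \<open>f \<noteq> g\<close>, the quotient of \<open>N\<close> by \<open>D\<close> is
  an invertible fractional linear function of \<open>p / s\<close>, so both have the same
  fibres.\<close>

lemma ratio_eq_iff:
  assumes "D1 = \<kappa> * (p1 + s1)" "D2 = \<kappa> * (p2 + s2)"
    and "N1 = f * p1 + g * s1" "N2 = f * p2 + g * s2" and "f \<noteq> g"
  shows "N1 * D2 = N2 * D1 \<longleftrightarrow> p1 * s2 = p2 * s1"
proof -
  have "N1 * D2 + N2 * D1 = \<kappa> * (f + g) * (p1 * s2 + p2 * s1)"
    unfolding assms by (simp add: algebra_simps)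
  moreover have "f + g \<noteq> 0"
    using assms(5) by (simp add: add_eq_0_iff_eq)
  ultimately show ?thesis
    using kappa_nonzero by (metis add_eq_0_iff_eq mult_eq_0_iff)
qed

lemma no_common_zero:
  assumes "\<kappa> * (p + s) = 0" "f * p + g * s = 0" "f \<noteq> g"
  shows "p = 0" "s = 0"
proof -
  have ps: "p = s"
    using assms(1) kappa_nonzero by (simp add: add_eq_0_iff_eq)
  with assms(2,3) show "s = 0"
    by (simp add: add_eq_0_iff_eq)
  with ps show "p = 0" by simp
qed

text \<open>Equality would make the constant term of \<open>D_parallel\<close> 0 instead of
  1.\<close>

lemma parallel_coeffs_neq:
  assumes "1 / e = a ^ Q + a + 1"
  shows "cj \<kappa> / r ^ (Q + 1) \<noteq> cj \<kappa> / r' ^ (Q + 1)"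
proof -
  have "\<kappa> * (r ^ Q * r + r' ^ Q * r') = 1"
    unfolding kappa_parallel using e_nonzero by (simp add: assms[symmetric])
  then have "r ^ Q * r \<noteq> r' ^ Q * r'"
    by auto
  then show ?thesis
    using kappa_nonzero r_nonzero r'_nonzero by (simp add: field_simps)
qed

lemma crossed_coeffs_neq:
  assumes "1 / e = a ^ Q + a"
  shows "cj \<kappa> / (r ^ Q * r') \<noteq> cj \<kappa> / (r * r' ^ Q)"
proof -
  have "\<kappa> * (r ^ Q * r' + r' ^ Q * r) = 1"
    unfolding kappa_crossed using e_nonzero by (simp add: assms[symmetric])
  then have "r ^ Q * r' \<noteq> r' ^ Q * r"
    by auto
  then show ?thesis
    using kappa_nonzero r_nonzero r'_nonzero by (simp add: field_simps)
qed

section \<open>Fibres of \<open>N / D\<close> on \<open>mu\<close>, and injectivity\<close>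

lemma parallel_fibre_iff:
  assumes "1 / e = a ^ Q + a + 1" "y \<in> mu" "z \<in> mu"
  shows "N y * D z = N z * D y \<longleftrightarrow>
    ((y + r) * (z + r')) ^ (Q + 1) = ((z + r) * (y + r')) ^ (Q + 1)"
  unfolding power_mult_distrib
  by (rule ratio_eq_iff[OF D_parallel D_parallel N_parallel N_parallel parallel_coeffs_neq])
    (rule assms)+

text \<open>In the coordinate \<open>X = (y + r) / (y + r')\<close> these are the fibres of
  \<open>X ^ (Q - 1)\<close>, and those of \<open>parallel_fibre_iff\<close> belong to
  \<open>X ^ (Q + 1)\<close>. Both are written without denominators.\<close>

lemma crossed_fibre_iff:
  assumes "1 / e = a ^ Q + a" "cj a = a" "y \<in> mu" "z \<in> mu"
  shows "N y * D z = N z * D y \<longleftrightarrow>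
    ((y + r) * (z + r')) ^ Q * ((z + r) * (y + r'))
      = ((z + r) * (y + r')) ^ Q * ((y + r) * (z + r'))"
proof -
  have "N y * D z = N z * D y \<longleftrightarrow>
    ((y + r) ^ Q * (y + r')) * ((z + r) * (z + r') ^ Q)
      = ((z + r) ^ Q * (z + r')) * ((y + r) * (y + r') ^ Q)"
    by (rule ratio_eq_iff[OF D_crossed D_crossed N_crossed N_crossed crossed_coeffs_neq])
      (rule assms)+
  then show ?thesis
    unfolding power_mult_distrib by (simp only: ac_simps)
qed

text \<open>A zero of \<open>D\<close> on \<open>mu\<close> is also a zero of \<open>N\<close>, so
  \<open>y + r\<close> and \<open>y + r'\<close> would both vanish.\<close>

lemma parallel_D_nonzero:
  assumes "1 / e = a ^ Q + a + 1" "y \<in> mu"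
  shows "D y \<noteq> 0"
proof
  assume D0: "D y = 0"
  then have N0: "N y = 0"
    by (simp add: N_eq assms(2))
  have "(y + r) ^ (Q + 1) = 0" "(y + r') ^ (Q + 1) = 0"
    using no_common_zero[OF D0[unfolded D_parallel[OF assms(1)]] N0[unfolded N_parallel[OF assms]]
        parallel_coeffs_neq[OF assms(1)]] by simp_all
  then have "y + r = 0" "y + r' = 0"
    by (simp_all only: power_eq_0_iff)
  then have "y + r = y + r'"
    by simp
  then show False
    using r_neq by simp
qed

text \<open>By conjugation, if one factor vanishes then so does the other, contradicting
  \<open>r \<noteq> r'\<close>.\<close>

lemma split_add_nonzero:
  assumes "cj a = a" "y \<in> mu"
  shows "y + r \<noteq> 0" "y + r' \<noteq> 0"
proof -
  have "y + r = 0 \<longleftrightarrow> y + r' = 0"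
    using cj_add_split(1)[OF assms] mu_nonzero[OF assms(2)] r'_nonzero
    by (metis cj_eq_0_iff divide_eq_0_iff mult_eq_0_iff)
  moreover have "y + r \<noteq> y + r'"
    using r_neq by simp
  ultimately show "y + r \<noteq> 0" "y + r' \<noteq> 0"
    by metis+
qed

lemma crossed_D_nonzero:
  assumes "1 / e = a ^ Q + a" "cj a = a" "y \<in> mu"
  shows "D y \<noteq> 0"
proof
  assume D0: "D y = 0"
  then have N0: "N y = 0"
    by (simp add: N_eq assms(3))
  have "(y + r) ^ Q * (y + r') = 0"
    using no_common_zero[OF D0[unfolded D_crossed[OF assms(1)]] N0[unfolded N_crossed[OF assms]]
        crossed_coeffs_neq[OF assms(1)]] by simp_all
  then show False
    using split_add_nonzero[OF assms(2,3)] by simp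
qed

lemma cross_products_eq:
  assumes "(y + r) * (z + r') = (z + r) * (y + r')"
  shows "y = z"
proof -
  have "(y + r) * (z + r') + (z + r) * (y + r') = (y + z) * (r + r')"
    by (simp add: algebra_simps)
  then have "(y + z) * (r + r') = 0"
    using assms by simp
  then show ?thesis
    using r_neq by (simp add: add_eq_0_iff_eq)
qed

text \<open>The coordinate maps \<open>mu\<close> into a single coset of \<open>mu\<close>, so
  ratios of its values have norm one.\<close>

lemma split_cross_norm:
  assumes "cj a = a" "y \<in> mu" "z \<in> mu"
  shows "((y + r) * (z + r')) ^ (q + 1) = ((z + r) * (y + r')) ^ (q + 1)"
  unfolding power_q_plus_1 cj_mult cj_add_split[OF assms(1,2)] cj_add_split[OF assms(1,3)]
  by (simp add: ac_simps)

lemma mu_injective_split_parallel: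
  assumes "1 / e = a ^ Q + a + 1" "cj a = a"
  shows mu_injective
  unfolding mu_injective_def
proof (intro conjI ballI impI)
  fix y z assume yz: "y \<in> mu" "z \<in> mu" and eq: "N y * D z = N z * D y"
  have "(y + r) * (z + r') = (z + r) * (y + r')"
  proof (rule power_eq_coprime[OF _ _ coprime_Q_q])
    show "((y + r) * (z + r')) ^ (Q + 1) = ((z + r) * (y + r')) ^ (Q + 1)"
      using eq parallel_fibre_iff[OF assms(1) yz] by simp
  qed (use split_cross_norm[OF assms(2) yz] split_add_nonzero[OF assms(2)] yz in auto)
  then show "y = z" by (rule cross_products_eq)
qed (rule parallel_D_nonzero[OF assms(1)])

lemma mu_injective_nonsplit_parallel:
  assumes "1 / e = a ^ Q + a + 1" "cj a = a + 1" "coprime (Q + 1) (q - 1)"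
  shows mu_injective
  unfolding mu_injective_def
proof (intro conjI ballI impI)
  fix y z assume yz: "y \<in> mu" "z \<in> mu" and eq: "N y * D z = N z * D y"
  let ?g = "(y + r) * (z + r')" and ?h = "(z + r) * (y + r')"
  have Q: "?g ^ (Q + 1) = ?h ^ (Q + 1)"
    using eq parallel_fibre_iff[OF assms(1) yz] by simp
  have "?g = ?h"
  proof (cases "?h = 0")
    case True
    have "?g ^ (Q + 1) = 0"
      unfolding Q True by simp
    then show ?thesis
      using True by (simp only: power_eq_0_iff)
  next
    case False
    then have "?g ^ (Q + 1) \<noteq> 0"
      unfolding Q by (simp only: power_eq_0_iff) simp
    then have "?g \<noteq> 0"
      by auto
    \<comment> \<open>Equal values of \<open>cj x / x\<close> mean that the ratio of
      \<open>?g\<close> and \<open>?h\<close> lies in the field with \<open>q\<close>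
      elements.\<close>
    have "cj ?g / ?g = 1 / (y * z * r * r')" "cj ?h / ?h = 1 / (y * z * r * r')"
      using False \<open>?g \<noteq> 0\<close> unfolding cj_mult cj_add_nonsplit[OF assms(2) yz(1)]
        cj_add_nonsplit[OF assms(2) yz(2)] by (simp_all add: ac_simps)
    then have "?g ^ (q - 1) = ?h ^ (q - 1)"
      unfolding power_q_minus_1[OF False] power_q_minus_1[OF \<open>?g \<noteq> 0\<close>] by simp
    then show ?thesis
      using power_eq_coprime[OF Q _ assms(3)] False by blast
  qed
  then show "y = z" by (rule cross_products_eq)
qed (rule parallel_D_nonzero[OF assms(1)])

lemma mu_injective_split_crossed:
  assumes "1 / e = a ^ Q + a" "cj a = a" "coprime (Q - 1) (q + 1)"
  shows mu_injective
  unfolding mu_injective_def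
proof (intro conjI ballI impI)
  fix y z assume yz: "y \<in> mu" "z \<in> mu" and eq: "N y * D z = N z * D y"
  let ?g = "(y + r) * (z + r')" and ?h = "(z + r) * (y + r')"
  have nz: "?g \<noteq> 0" "?h \<noteq> 0"
    using split_add_nonzero[OF assms(2)] yz by auto
  have "?g ^ Q * ?h = ?h ^ Q * ?g"
    using eq crossed_fibre_iff[OF assms(1,2) yz] by simp
  moreover have "x ^ Q = x ^ (Q - 1) * x" for x :: 'a
    using Q_gt_1 by (intro power_minus_mult[symmetric]) simp
  ultimately have "?g ^ (Q - 1) * ?g * ?h = ?h ^ (Q - 1) * ?h * ?g"
    by metis
  then have "?g ^ (Q - 1) * (?g * ?h) = ?h ^ (Q - 1) * (?g * ?h)"
    by (simp only: ac_simps)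
  then have "?g ^ (Q - 1) = ?h ^ (Q - 1)"
    using nz by (metis mult_cancel_right mult_eq_0_iff)
  then have "?g = ?h"
    using power_eq_coprime[OF _ split_cross_norm[OF assms(2) yz] assms(3)] nz by blast
  then show "y = z" by (rule cross_products_eq)
qed (rule crossed_D_nonzero[OF assms(1,2)])

section \<open>Failure of injectivity\<close>

lemma not_mu_injective_nonsplit_crossed:
  assumes "1 / e = a ^ Q + a" "cj a = a + 1"
  shows "\<not> mu_injective"
proof -
  have "D r = 0"
    using Q_gt_1 by (simp add: D_crossed[OF assms(1)])
  then show ?thesis
    using conj_nonsplit(1)[OF assms(2)] unfolding mu_injective_def by blast
qed

text \<open>The inverse of the coordinate \<open>y \<mapsto> (y + r) / (y + r')\<close>.\<close>
definition Y :: "'a \<Rightarrow> 'a" where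
  "Y X = (r + r' * X) / (1 + X)"

lemma Y_add:
  assumes "X \<noteq> 1"
  shows "Y X + r = (r + r') * X / (1 + X)" "Y X + r' = (r + r') / (1 + X)"
proof -
  have "1 + X \<noteq> 0"
    using assms by (auto simp: add_eq_0_iff_eq)
  then have "Y X + r = (r + r' * X + r * (1 + X)) / (1 + X)"
    "Y X + r' = (r + r' * X + r' * (1 + X)) / (1 + X)"
    by (simp_all add: Y_def add_divide_distrib)
  then show "Y X + r = (r + r') * X / (1 + X)" "Y X + r' = (r + r') / (1 + X)"
    by (simp_all add: algebra_simps)
qed

lemma Y_cross:
  assumes "X \<noteq> 1" "Z \<noteq> 1"
  shows "(Y X + r) * (Y Z + r') = (r + r')\<^sup>2 / ((1 + X) * (1 + Z)) * X"
  by (simp add: Y_add assms power2_eq_square)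

text \<open>Scaling the coordinate by a root of unity \<open>z\<close> of suitable order thus
  produces a second point in the same fibre.\<close>

lemma Y_cross_scale:
  assumes "X \<noteq> 1" "z * X \<noteq> 1"
  shows "(Y (z * X) + r) * (Y X + r') = z * ((Y X + r) * (Y (z * X) + r'))"
  unfolding Y_cross[OF assms] Y_cross[OF assms(2,1)] by (simp add: ac_simps)

lemma Y_neq:
  assumes "X \<noteq> 1" "Z \<noteq> 1" "X \<noteq> Z"
  shows "Y X \<noteq> Y Z"
proof
  assume eq: "Y X = Y Z"
  have nz: "r + r' \<noteq> 0" "1 + X \<noteq> 0" "1 + Z \<noteq> 0"
    using assms r_neq by (auto simp: add_eq_0_iff_eq)
  let ?g = "(r + r')\<^sup>2 / ((1 + X) * (1 + Z))"
  have "?g * X = (Y X + r) * (Y Z + r')"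
    by (rule Y_cross[OF assms(1,2), symmetric])
  also have "\<dots> = (Y Z + r) * (Y X + r')"
    by (simp add: eq)
  also have "\<dots> = ?g * Z"
    unfolding Y_cross[OF assms(2,1)] by (simp only: mult.commute)
  finally have "?g * (X + Z) = 0"
    by (simp only: distrib_left add_self)
  moreover have "?g \<noteq> 0"
    using nz by simp
  ultimately show False
    using assms(3) by (simp only: mult_eq_0_iff add_eq_0_iff_eq) blast
qed

text \<open>The equation for \<open>X\<close> describes the coset of \<open>mu\<close> that consists
  of the coordinates of points of \<open>mu\<close>.\<close>

lemma Y_in_mu_split:
  assumes "cj a = a" and X: "X * cj X = r / r'"
  shows "X \<noteq> 1 \<and> Y X \<in> mu"
proof -
  have X1: "X \<noteq> 1"
    using X r_neq r'_nonzero by auto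
  have X0: "X \<noteq> 0"
    using X r_nonzero r'_nonzero by auto
  have cX: "cj X = r / (r' * X)"
  proof -
    have "cj X = (X * cj X) / X"
      using X0 by simp
    also have "\<dots> = r / (r' * X)"
      unfolding X by simp
    finally show ?thesis .
  qed
  have nz: "1 + X \<noteq> 0" "1 + cj X \<noteq> 0"
    using X1 by (metis add_eq_0_iff_eq cj_1 cj_eq_iff)+
  have "cj (Y X) = (1 / r' + cj X / r) / (1 + cj X)"
    using conj_split[OF assms(1)] by (simp add: Y_def cj_simps)
  also have "1 / r' + cj X / r = (1 + X) / (r' * X)"
    using X0 r_nonzero r'_nonzero by (simp add: cX add_divide_distrib)
  also have "1 + cj X = (r + r' * X) / (r' * X)"
    using X0 r'_nonzero by (simp add: cX add_divide_distrib add.commute)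
  finally have "cj (Y X) = (1 + X) / (r + r' * X)"
    using X0 r'_nonzero by simp
  moreover have "r + r' * X \<noteq> 0"
    using nz(2) \<open>1 + cj X = (r + r' * X) / (r' * X)\<close> by auto
  ultimately show ?thesis
    using nz X1 by (simp add: mu_def Y_def)
qed

text \<open>The coordinates of points of \<open>mu\<close> other than \<open>r'\<close> now form a
  line over the field with \<open>q\<close> elements.\<close>

lemma Y_in_mu_nonsplit:
  assumes "cj a = a + 1" and X: "r * cj X = r' * X"
  shows "X \<noteq> 1 \<and> Y X \<in> mu"
proof -
  have X1: "X \<noteq> 1"
    using X r_neq by auto
  have cX: "cj X = r' * X / r"
    using X r_nonzero by (simp add: field_simps)
  have nz: "1 + X \<noteq> 0" "1 + cj X \<noteq> 0"
    using X1 by (metis add_eq_0_iff_eq cj_1 cj_eq_iff)+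
  have "cj (Y X) = (1 / r + cj X / r') / (1 + cj X)"
    using conj_nonsplit[OF assms(1)] by (simp add: Y_def cj_simps mu_cj)
  also have "1 / r + cj X / r' = (1 + X) / r"
    using r'_nonzero by (simp add: cX add_divide_distrib)
  also have "1 + cj X = (r + r' * X) / r"
    using r_nonzero by (simp add: cX add_divide_distrib)
  finally have "cj (Y X) = (1 + X) / (r + r' * X)"
    using r_nonzero by simp
  moreover have "r + r' * X \<noteq> 0"
    using nz(2) \<open>1 + cj X = (r + r' * X) / r\<close> by auto
  ultimately show ?thesis
    using nz X1 by (simp add: mu_def Y_def)
qed

lemma not_mu_injective_nonsplit_parallel:
  assumes "1 / e = a ^ Q + a + 1" "cj a = a + 1"
    and z: "z \<noteq> (1 :: 'a)" "z ^ (Q + 1) = 1" "z ^ (q - 1) = 1"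
  shows "\<not> mu_injective"
proof -
  have "z \<noteq> 0"
    using z(2) by auto
  then have cz: "cj z = z"
    using z(3) by (simp add: power_q_minus_1 del: One_nat_def)
  \<comment> \<open>The parameter \<open>a\<close> itself lies on this line, and \<open>z\<close>,
    being fixed by conjugation, preserves the line.\<close>
  have a: "r * cj a = r' * a"
    by (simp add: r_def r'_def assms(2))
  then have "r * cj (z * a) = r' * (z * a)"
    by (simp add: cj_mult cz ac_simps)
  note Y = Y_in_mu_nonsplit[OF assms(2) a] Y_in_mu_nonsplit[OF assms(2) this]
  have "((Y a + r) * (Y (z * a) + r')) ^ (Q + 1) = ((Y (z * a) + r) * (Y a + r')) ^ (Q + 1)"
    using Y z(2) by (subst Y_cross_scale) (simp_all add: power_mult_distrib del: power_Suc)
  then have "N (Y a) * D (Y (z * a)) = N (Y (z * a)) * D (Y a)"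
    using parallel_fibre_iff[OF assms(1)] Y by simp
  moreover have "Y a \<noteq> Y (z * a)"
    using Y z(1) a_nonzero by (intro Y_neq) auto
  ultimately show ?thesis
    using Y unfolding mu_injective_def by blast
qed

lemma not_mu_injective_split_crossed:
  assumes "1 / e = a ^ Q + a" "cj a = a"
    and z: "z \<noteq> (1 :: 'a)" "z ^ (Q - 1) = 1" "z ^ (q + 1) = 1"
  shows "\<not> mu_injective"
proof -
  \<comment> \<open>The coordinate of the point 1 of \<open>mu\<close>; scaling by \<open>z\<close>,
    which has norm one, keeps it in the coset.\<close>
  define X where "X = (1 + r) / (1 + r')"
  have nz: "1 + r \<noteq> 0" "1 + r' \<noteq> 0"
    using split_add_nonzero[OF assms(2) one_in_mu] by auto
  have X: "X * cj X = r / r'"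
    using cj_add_split[OF assms(2) one_in_mu] nz r_nonzero r'_nonzero
    by (simp add: X_def cj_divide)
  have "z * cj z = 1"
    using z(3) by (simp only: power_q_plus_1)
  moreover have "(z * X) * cj (z * X) = (z * cj z) * (X * cj X)"
    by (simp add: cj_mult ac_simps)
  ultimately have "(z * X) * cj (z * X) = r / r'"
    using X by simp
  note Y = Y_in_mu_split[OF assms(2) X] Y_in_mu_split[OF assms(2) this]
  have "z ^ Q = z ^ (Q - 1) * z"
    using Q_gt_1 by (intro power_minus_mult[symmetric]) simp
  then have zQ: "z ^ Q = z"
    using z(2) by simp
  have "((Y X + r) * (Y (z * X) + r')) ^ Q * ((Y (z * X) + r) * (Y X + r'))
      = ((Y (z * X) + r) * (Y X + r')) ^ Q * ((Y X + r) * (Y (z * X) + r'))"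
    using Y by (subst (1 2) Y_cross_scale) (simp_all add: power_mult_distrib zQ)
  then have "N (Y X) * D (Y (z * X)) = N (Y (z * X)) * D (Y X)"
    using crossed_fibre_iff[OF assms(1,2)] Y by simp
  moreover have "Y X \<noteq> Y (z * X)"
    using Y z(1) nz by (intro Y_neq) (auto simp: X_def)
  ultimately show ?thesis
    using Y unfolding mu_injective_def by blast
qed

end

section \<open>Power sums over the unit circle\<close>

context quadratic_extension
begin

text \<open>This is \<open>(x ^ q - y ^ q) / (x - y)\<close> as a geometric sum; for
  \<open>x = y\<close> its \<open>q\<close> equal terms cancel.\<close>

lemma binomial_q_minus_1: "(x + y) ^ (q - 1) = (\<Sum>i<q. y ^ (q - Suc i) * (x::'a) ^ i)"
proof (cases "x = y")
  case True
  have "(\<Sum>i<q. y ^ (q - Suc i) * x ^ i) = (\<Sum>i<q. y ^ (q - 1))"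
    unfolding True by (intro sum.cong) (auto simp: power_add[symmetric])
  also have "\<dots> = 0"
    using even_q two_eq_0 by (auto elim!: evenE)
  finally show ?thesis
    using True q_gt_1 by (simp add: zero_power)
next
  case False
  then have nz: "x + y \<noteq> 0"
    by (simp add: add_eq_0_iff_eq)
  have "(x + y) * (x + y) ^ (q - 1) = (x + y) ^ q"
    using q_gt_1 by (simp flip: power_Suc)
  also have "\<dots> = x ^ q - y ^ q"
    by (simp add: minus_eq_plus flip: cj_def) (rule cj_add)
  also have "\<dots> = (x + y) * (\<Sum>i<q. y ^ (q - Suc i) * x ^ i)"
    using power_diff_sumr2[of x q y] by (simp only: minus_eq_plus)
  finally show ?thesis
    using nz by simp
qed

lemma power_sum_norm:
  "(\<Sum>x\<in>UNIV - {0::'a}. x ^ ((q - 1) * n)) = (if (q + 1) dvd n then 1 else 0)"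
proof (cases "(q + 1) dvd n")
  case True
  then obtain j where j: "n = (q + 1) * j" by auto
  have "x ^ ((q - 1) * n) = 1" if "x \<noteq> 0" for x :: 'a
    using finite_field_power_card_minus_1[OF that]
    by (simp add: j card_minus_1 mult.assoc[symmetric] power_mult del: One_nat_def)
  then have "(\<Sum>x\<in>UNIV - {0::'a}. x ^ ((q - 1) * n)) = (\<Sum>x\<in>UNIV - {0::'a}. 1)"
    by (intro sum.cong) auto
  also have "\<dots> = of_nat (CARD('a) - 1)"
    by (simp add: card_Diff_singleton)
  also have "\<dots> = 1"
  proof -
    have "odd (CARD('a) - 1)"
      unfolding card_minus_1 using even_q q_gt_1 by simp
    then show ?thesis
      using two_eq_0 by (auto elim!: oddE)
  qed
  finally show ?thesis
    using True by simp
next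
  case False
  then have "\<not> (CARD('a) - 1) dvd (q - 1) * n"
    unfolding card_minus_1 nat_mult_dvd_cancel_disj using q_gt_1 by simp
  then show ?thesis
    using False sum_power_finite_field by (simp del: One_nat_def)
qed

text \<open>Since \<open>cj x = x ^ q\<close>, the \<open>i\<close>-th term of the expansion is a
  monomial of exponent \<open>(q - 1) * (n + (q - i))\<close>, and \<open>power_sum_norm\<close>
  decides its sum.\<close>

lemma weighted_form_sum:
  "(\<Sum>x\<in>UNIV - {0}. x ^ ((q - 1) * n) * (f * x + g * cj x) ^ (q - 1))
    = (\<Sum>i<q. if (q + 1) dvd (n + (q - i)) then g ^ (q - Suc i) * f ^ i else 0)"
proof -
  have *: "x ^ ((q - 1) * n) * ((g * cj x) ^ (q - Suc i) * (f * x) ^ i)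
      = g ^ (q - Suc i) * f ^ i * x ^ ((q - 1) * (n + (q - i)))" if "i < q" for x i
  proof -
    have eq: "q * (q - Suc i) + i = (q - 1) * (q - i)"
    proof -
      obtain j where "q = Suc (i + j)"
        using \<open>i < q\<close> less_iff_Suc_add by blast
      then show ?thesis
        by (simp add: algebra_simps)
    qed
    have "(q - 1) * (n + (q - i)) = (q - 1) * n + (q * (q - Suc i) + i)"
      unfolding distrib_left eq ..
    then have "x ^ ((q - 1) * (n + (q - i))) = x ^ ((q - 1) * n) * (cj x ^ (q - Suc i) * x ^ i)"
      by (simp only: power_add cj_def power_mult)
    then show ?thesis
      by (simp add: power_mult_distrib)
  qed
  have "(\<Sum>x\<in>UNIV - {0}. x ^ ((q - 1) * n) * (f * x + g * cj x) ^ (q - 1))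
      = (\<Sum>x\<in>UNIV - {0}. \<Sum>i<q. g ^ (q - Suc i) * f ^ i * x ^ ((q - 1) * (n + (q - i))))"
    unfolding binomial_q_minus_1 sum_distrib_left using * by (intro sum.cong) auto
  also have "\<dots> = (\<Sum>i<q. g ^ (q - Suc i) * f ^ i * (\<Sum>x\<in>UNIV - {0}. x ^ ((q - 1) * (n + (q - i)))))"
    by (subst sum.swap) (simp only: sum_distrib_left)
  also have "\<dots> = (\<Sum>i<q. if (q + 1) dvd (n + (q - i)) then g ^ (q - Suc i) * f ^ i else 0)"
    unfolding power_sum_norm by (intro sum.cong) auto
  finally show ?thesis .
qed

text \<open>This is the weight \<open>n = 0\<close>: the numbers \<open>q - i\<close> run from 1 to
  \<open>q\<close>, and none is divisible by \<open>q + 1\<close>.\<close>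

lemma sum_mu_form: "(\<Sum>t\<in>mu. t * (f + g * t) ^ (q - 1)) = 0"
proof -
  have "(\<Sum>t\<in>mu. t * (f + g * t) ^ (q - 1))
      = (\<Sum>x\<in>UNIV - {0}. x ^ (q - 1) * (f + g * x ^ (q - 1)) ^ (q - 1))"
    by (rule sum_mu[symmetric])
  also have "\<dots> = (\<Sum>x\<in>UNIV - {0}. x ^ ((q - 1) * 0) * (f * x + g * cj x) ^ (q - 1))"
  proof (intro sum.cong refl)
    fix x :: 'a assume "x \<in> UNIV - {0}"
    then have "x \<noteq> 0" by simp
    then have "x * (f + g * x ^ (q - 1)) = f * x + g * cj x"
      by (simp add: power_q_minus_1 distrib_left del: One_nat_def)
    then show "x ^ (q - 1) * (f + g * x ^ (q - 1)) ^ (q - 1)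
        = x ^ ((q - 1) * 0) * (f * x + g * cj x) ^ (q - 1)"
      by (simp add: power_mult_distrib[symmetric] del: One_nat_def)
  qed
  also have "\<dots> = (\<Sum>i<q. 0)"
    unfolding weighted_form_sum by (intro sum.cong) (auto dest: dvd_imp_le)
  finally show ?thesis by simp
qed

end

section \<open>Hermite sums for \<open>N / D\<close>\<close>

context projective_map
begin

text \<open>At weight \<open>Q\<close> only the index \<open>j\<close> survives, leaving one
  monomial in \<open>f\<close> and \<open>g\<close>. The residue \<open>j = q\<close> would be out
  of range; it is excluded because \<open>q + 1\<close> is coprime to the power of two
  \<open>Q\<close>.\<close>

lemma weighted_form_sum_zero:
  assumes "(\<Sum>x\<in>UNIV - {0}. x ^ ((q - 1) * Q) * (f * x + g * cj x) ^ (q - 1)) = 0"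
  shows "f = 0 \<or> g = 0"
proof -
  define j where "j = (Q + q) mod (q + 1)"
  have "j \<noteq> q"
  proof
    assume "j = q"
    then have "(Q + q) mod (q + 1) = q mod (q + 1)"
      by (simp add: j_def)
    then have "(q + 1) dvd Q"
      using mod_eq_dvd_iff_nat[of q "Q + q" "q + 1"] by simp
    moreover have "coprime (q + 1) Q"
      using even_q by (simp add: Q_def)
    ultimately have "q + 1 = 1"
      by (meson coprime_absorb_left nat_dvd_1_iff_1 coprime_common_divisor dvd_refl)
    then show False
      using q_gt_1 by simp
  qed
  moreover have "j \<le> q"
    using mod_less_divisor[of "q + 1" "Q + q"] by (simp add: j_def del: mod_less_divisor)
  ultimately have j: "j < q" by simp
  have dvd_iff: "(q + 1) dvd (Q + (q - i)) \<longleftrightarrow> i = j" if "i < q" for i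
  proof -
    have "(q + 1) dvd (Q + (q - i)) \<longleftrightarrow> (Q + q) mod (q + 1) = i mod (q + 1)"
      using mod_eq_dvd_iff_nat[of i "Q + q" "q + 1"] that by simp
    then show ?thesis
      using that by (auto simp: j_def)
  qed
  have "0 = (\<Sum>i<q. if (q + 1) dvd (Q + (q - i)) then g ^ (q - Suc i) * f ^ i else 0)"
    using assms unfolding weighted_form_sum by simp
  also have "\<dots> = (\<Sum>i<q. if i = j then g ^ (q - Suc i) * f ^ i else 0)"
    using dvd_iff by (intro sum.cong) auto
  also have "\<dots> = g ^ (q - Suc j) * f ^ j"
    using j by simp
  finally show ?thesis by auto
qed

lemma mu_injective_imp_bij_betw:
  assumes mu_injective
  shows "bij_betw (\<lambda>y. N y / D y) mu mu"
proof -
  have D: "D y \<noteq> 0" if "y \<in> mu" for y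
    using assms that unfolding mu_injective_def by blast
  have "inj_on (\<lambda>y. N y / D y) mu"
  proof (rule inj_onI)
    fix y z assume yz: "y \<in> mu" "z \<in> mu" and eq: "N y / D y = N z / D z"
    then have "N y * D z = N z * D y"
      using D by (simp add: frac_eq_eq)
    then show "y = z"
      using assms yz unfolding mu_injective_def by blast
  qed
  moreover have "(\<lambda>y. N y / D y) ` mu \<subseteq> mu"
  proof safe
    fix y assume y: "y \<in> mu"
    then have "N y / D y = y ^ (Q + 1) * (D y ^ (q - 1))"
      using D by (simp add: N_eq power_q_minus_1 del: One_nat_def)
    then show "N y / D y \<in> mu"
      using y D by (simp only:) (intro mu_mult mu_power power_q_minus_1_in_mu)
  qed
  ultimately show ?thesis
    by (intro bij_betw_imageI endo_inj_surj) auto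
qed

text \<open>Substitute \<open>t = N y / D y\<close>, which equals
  \<open>y ^ (Q + 1) * D y ^ (q - 1)\<close>, in \<open>sum_mu_form\<close>.\<close>

lemma hermite_sum:
  assumes mu_injective
  shows "(\<Sum>y\<in>mu. y ^ (Q + 1) * (f * D y + g * N y) ^ (q - 1)) = 0"
proof -
  have "(\<Sum>y\<in>mu. y ^ (Q + 1) * (f * D y + g * N y) ^ (q - 1))
      = (\<Sum>y\<in>mu. (N y / D y) * (f + g * (N y / D y)) ^ (q - 1))"
  proof (intro sum.cong refl)
    fix y assume y: "y \<in> mu"
    have D: "D y \<noteq> 0"
      using assms y unfolding mu_injective_def by blast
    have "f * D y + g * N y = D y * (f + g * (N y / D y))"
      using D by (simp add: distrib_left)
    then have "y ^ (Q + 1) * (f * D y + g * N y) ^ (q - 1)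
        = (y ^ (Q + 1) * D y ^ (q - 1)) * (f + g * (N y / D y)) ^ (q - 1)"
      by (simp only: power_mult_distrib mult.assoc)
    also have "y ^ (Q + 1) * D y ^ (q - 1) = N y / D y"
      using D y by (simp add: N_eq power_q_minus_1 del: One_nat_def)
    finally show "y ^ (Q + 1) * (f * D y + g * N y) ^ (q - 1)
        = (N y / D y) * (f + g * (N y / D y)) ^ (q - 1)" .
  qed
  also have "\<dots> = (\<Sum>t\<in>mu. t * (f + g * t) ^ (q - 1))"
    by (rule sum.reindex_bij_betw[OF mu_injective_imp_bij_betw[OF assms]])
  finally show ?thesis
    by (simp only: sum_mu_form)
qed

text \<open>The map is additive, and \<open>cj z = r * z\<close> implies
  \<open>z = (r * cj r) * z\<close>, so its kernel is trivial.\<close>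

lemma bij_betw_norm_form:
  assumes "r * cj r \<noteq> 1"
  shows "bij_betw (\<lambda>z. cj z + r * z) (UNIV - {0}) (UNIV - {0})"
proof -
  have zero: "z = 0" if "cj z + r * z = 0" for z
  proof -
    have cz: "cj z = r * z"
      using that by (simp add: add_eq_0_iff_eq)
    have "z = cj (cj z)"
      by simp
    also have "\<dots> = cj r * (r * z)"
      by (simp only: cz cj_mult)
    finally have "z = (r * cj r) * z"
      by (simp only: ac_simps)
    then show ?thesis
      using assms by simp
  qed
  have "inj (\<lambda>z. cj z + r * z)"
  proof (rule injI)
    fix z w assume eq: "cj z + r * z = cj w + r * w"
    have "cj (z + w) + r * (z + w) = (cj z + r * z) + (cj w + r * w)"
      by (simp add: cj_add distrib_left ac_simps)
    then show "z = w"
      using zero[of "z + w"] eq by (simp add: add_eq_0_iff_eq)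
  qed
  then have "inj_on (\<lambda>z. cj z + r * z) (UNIV - {0})"
    by (rule inj_on_subset) simp
  moreover have "(\<lambda>z. cj z + r * z) ` (UNIV - {0}) \<subseteq> UNIV - {0}"
    by (auto dest: zero)
  ultimately show ?thesis
    using endo_inj_surj[of "UNIV - {0}" "\<lambda>z. cj z + r * z"] by (intro bij_betw_imageI) simp_all
qed

text \<open>With \<open>y = z ^ (q - 1)\<close> and \<open>x = cj z + r * z = z * (y + r)\<close>,
  the factored Hermite sum becomes the weighted sum of \<open>s * x + t * cj x\<close>.\<close>

lemma hermite_factor:
  assumes inj: mu_injective and r: "r * cj r \<noteq> 1"
    and factor: "\<And>y. f * D y + g * N y = (y + r) ^ Q * (s * (y + r) + t * (1 + cj r * y))"
  shows "s = 0 \<or> t = 0"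
proof -
  let ?H = "\<lambda>x. x ^ ((q - 1) * Q) * (s * x + t * cj x) ^ (q - 1)"
  have "(\<Sum>x\<in>UNIV - {0}. ?H x) = (\<Sum>z\<in>UNIV - {0}. ?H (cj z + r * z))"
    by (rule sum.reindex_bij_betw[OF bij_betw_norm_form[OF r], symmetric])
  also have "\<dots> = (\<Sum>z\<in>UNIV - {0}. (z ^ (q - 1)) ^ (Q + 1)
      * (f * D (z ^ (q - 1)) + g * N (z ^ (q - 1))) ^ (q - 1))"
  proof (intro sum.cong refl)
    fix z :: 'a assume "z \<in> UNIV - {0}"
    then have z: "z \<noteq> 0" by simp
    define y where "y = z ^ (q - 1)"
    have y: "cj z = z * y"
      using z by (simp add: y_def power_q_minus_1 del: One_nat_def)
    have x: "cj z + r * z = z * (y + r)"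
      by (simp add: y distrib_left)
    have "cj (cj z + r * z) = z + cj r * cj z"
      by (simp add: cj_add cj_mult)
    also have "\<dots> = z * (1 + cj r * y)"
      by (simp add: y distrib_left)
    finally have "s * (cj z + r * z) + t * cj (cj z + r * z)
        = z * (s * (y + r) + t * (1 + cj r * y))"
      unfolding x by (simp add: distrib_left)
    then have "?H (cj z + r * z) = (z * (y + r)) ^ ((q - 1) * Q)
        * (z * (s * (y + r) + t * (1 + cj r * y))) ^ (q - 1)"
      unfolding x by simp
    also have "\<dots> = (z ^ ((q - 1) * Q) * z ^ (q - 1))
        * ((y + r) ^ (Q * (q - 1)) * (s * (y + r) + t * (1 + cj r * y)) ^ (q - 1))"
      by (simp only: power_mult_distrib ac_simps)
    also have "z ^ ((q - 1) * Q) * z ^ (q - 1) = y ^ (Q + 1)"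
      by (simp only: y_def power_mult power_add power_one_right)
    also have "y ^ (Q + 1) * ((y + r) ^ (Q * (q - 1)) * (s * (y + r) + t * (1 + cj r * y)) ^ (q - 1))
        = y ^ (Q + 1) * (f * D y + g * N y) ^ (q - 1)"
      unfolding factor power_mult_distrib power_mult ..
    finally show "?H (cj z + r * z) = (z ^ (q - 1)) ^ (Q + 1)
      * (f * D (z ^ (q - 1)) + g * N (z ^ (q - 1))) ^ (q - 1)"
      unfolding y_def .
  qed
  also have "\<dots> = (\<Sum>y\<in>mu. y ^ (Q + 1) * (f * D y + g * N y) ^ (q - 1))"
    by (rule sum_mu)
  also have "\<dots> = 0"
    by (rule hermite_sum[OF inj])
  finally show ?thesis
    by (rule weighted_form_sum_zero)
qed

lemma c_zero_if_b_zero: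
  assumes mu_injective "b = 0"
  shows "c = 0"
proof -
  have "(1::'a) = 0 \<or> cj c = 0"
  proof (rule hermite_factor[OF assms(1)])
    \<comment> \<open>For \<open>b = 0\<close> the numerator \<open>N y = y ^ Q * (y + cj c)\<close>
      is already factored, with \<open>r = 0\<close>.\<close>
    show "0 * D y + 1 * N y = (y + 0) ^ Q * (1 * (y + 0) + cj c * (1 + cj 0 * y))" for y
      unfolding N_def using assms(2) by (simp add: distrib_left)
  qed simp
  then show ?thesis by simp
qed

end

section \<open>Condition (2) in the split case\<close>

context ramification
begin

lemma condition2_split:
  assumes inj: mu_injective and split: "cj a = a"
  shows "c = ep ^ (Q - 1) * bt"
proof -
  define p where "p = r ^ Q"
  define p' where "p' = r' ^ Q"
  have pnz: "p \<noteq> 0" "p' \<noteq> 0"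
    using r_nonzero r'_nonzero by (simp_all add: p_def p'_def)
  have cb: "cj b = b * p * p'"
    using b_nonzero by (simp add: p_def p'_def mult.assoc rQ_mult)
  have cp: "cj p = 1 / p'"
    using conj_split(1)[OF split] by (simp add: p_def p'_def cj_power power_divide)
  \<comment> \<open>The combination \<open>f * D y + g * N y\<close> shall be divisible by
    \<open>(y + r) ^ Q\<close>. Generically \<open>f = p + cj b\<close> and \<open>g = c\<close>
    work; if both are 0, take \<open>f = 0\<close> and \<open>g = 1\<close>.\<close>
  obtain f g where fg: "f \<noteq> 0 \<or> g \<noteq> 0"
    and eq1: "p * g = f * c + g * cj b" and eq2: "p * (f * b + g * cj c) = f"
  proof (cases "c = 0 \<and> p = cj b")
    case True
    have "1 + p * b \<noteq> 0"
      using e_nonzero True unfolding e_def by (simp add: mult.commute)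
    then show ?thesis
      using that[of 0 1] True by simp
  next
    case False
    have "p * c * cj c + (p + cj b) * (1 + p * b) = b * p\<^sup>2 + e * p + cj b"
      by (simp add: e_def power2_eq_square algebra_simps)
    also have "\<dots> = 0"
      using rQ_root by (simp add: p_def)
    finally have "p * c * cj c = (p + cj b) * (1 + p * b)"
      by (simp only: add_eq_0_iff_eq)
    then have "p * ((p + cj b) * b + c * cj c) = p * (p + cj b) * b + (p + cj b) * (1 + p * b)"
      by (simp add: distrib_left ac_simps)
    also have "\<dots> = p + cj b"
      by (simp add: algebra_simps)
    finally have "p * ((p + cj b) * b + c * cj c) = p + cj b" .
    moreover have "p * c = (p + cj b) * c + c * cj b"
      by (simp add: algebra_simps)
    moreover have "p + cj b \<noteq> 0 \<or> c \<noteq> 0"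
      using False by (auto simp: add_eq_0_iff_eq)
    ultimately show ?thesis
      using that by blast
  qed
  define M where "M = f * b + g * cj c"
  define d where "d = 1 + r * cj r"
  have norm: "r * cj r \<noteq> 1"
    using conj_split(1)[OF split] r_neq r'_nonzero by simp
  then have d: "d \<noteq> 0"
    by (metis d_def add_eq_0_iff_eq)
  \<comment> \<open>These are the coefficients of the cofactor \<open>g * y + M\<close> in the basis
    \<open>y + r\<close>, \<open>1 + cj r * y\<close>, which is independent as
    \<open>d \<noteq> 0\<close>.\<close>
  have "(g + cj r * M) / d = 0 \<or> (M + r * g) / d = 0"
  proof (rule hermite_factor[OF inj norm])
    fix y
    have "(g + cj r * M) * (y + r) + (M + r * g) * (1 + cj r * y) = d * (g * y + M)"
      by (simp add: d_def algebra_simps)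
    then have L: "(g + cj r * M) / d * (y + r) + (M + r * g) / d * (1 + cj r * y) = g * y + M"
      using d by (simp only: times_divide_eq_left add_divide_distrib[symmetric]) simp
    have "f * D y + g * N y = y ^ Q * (g * y + M) + ((f * c + g * cj b) * y + f)"
      by (simp add: D_def N_def M_def algebra_simps)
    also have "(f * c + g * cj b) * y + f = p * (g * y + M)"
      using eq1 eq2 by (simp add: M_def distrib_left)
    finally show "f * D y + g * N y
        = (y + r) ^ Q * ((g + cj r * M) / d * (y + r) + (M + r * g) / d * (1 + cj r * y))"
      unfolding L p_def power_Q_add by (simp only: distrib_right)
  qed
  \<comment> \<open>So the remaining zero of the fibre is \<open>r\<close> or
    \<open>r' = 1 / cj r\<close>.\<close>
  then have "M = r' * g \<or> M = r * g"
  proof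
    assume "(g + cj r * M) / d = 0"
    then have "g = cj r * M"
      using d by (simp add: add_eq_0_iff_eq)
    then show ?thesis
      using conj_split(1)[OF split] r'_nonzero by simp
  qed (use d in \<open>simp add: add_eq_0_iff_eq\<close>)
  then obtain s s' where s: "M = s * g" and ss': "s = r \<and> s' = r' \<or> s = r' \<and> s' = r"
    by blast
  have cs: "cj s = 1 / s'" "s' \<noteq> 0"
    using ss' conj_split[OF split] r_nonzero r'_nonzero by auto
  have f: "f = p * s * g"
    using eq2 s by (simp add: M_def ac_simps)
  then have g: "g \<noteq> 0"
    using fg by auto
  have "g * p = g * (p * s * c + cj b)"
    using eq1 f by (simp add: algebra_simps)
  then have "p = p * s * c + cj b"
    unfolding mult_cancel_left using g by blast
  also have "\<dots> = p * (s * c + b * p')"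
    by (simp add: cb algebra_simps)
  finally have "p * 1 = p * (s * c + b * p')"
    by (simp only: mult_1_right)
  \<comment> \<open>\<open>A\<close>, and \<open>B\<close> obtained below by conjugation, take the
    place of the two relations used in \<open>condition2_nonsplit\<close>.\<close>
  then have A: "1 = s * c + b * p'"
    using pnz by (simp only: mult_cancel_left) simp
  have "g * (p * s * b + cj c) = g * s"
    using s f by (simp add: M_def algebra_simps)
  then have "p * s * b + cj c = s"
    using g by simp
  then have "cj (p * s * b + cj c) = cj s"
    by simp
  then have "cj b / (p' * s') + c = 1 / s'"
    by (simp add: cj_add cj_mult cp cs)
  then have "(b * p / s' + c) * s' = (1 / s') * s'"
    using pnz cs by (simp add: cb)
  moreover have "(b * p / s' + c) * s' = b * p + s' * c"
    using cs by (simp add: distrib_right mult.commute[of c])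
  ultimately have B: "1 = b * p + s' * c"
    using cs by simp
  have "c * (s + s') + b * (p + p') = (s * c + b * p') + (b * p + s' * c)"
    by (simp add: algebra_simps)
  also have "\<dots> = 0"
    unfolding A[symmetric] B[symmetric] by simp
  finally have "c * (s + s') = b * (p + p')"
    by (simp only: add_eq_0_iff_eq)
  moreover have "s + s' = r + r'"
    using ss' by (auto simp: add.commute)
  ultimately show ?thesis
    by (intro condition2I) (simp add: p_def p'_def)
qed

end

section \<open>The trace condition\<close>

lemma diff_dvd_power_diff: "(x - y :: 'a::comm_ring_1) dvd x ^ n - y ^ n"
  unfolding power_diff_sumr2 by simp

lemma Suc_dvd_power_Suc:
  assumes "odd n"
  shows "x + 1 dvd x ^ n + (1::nat)"
proof -
  have "int x - (- 1) dvd int x ^ n - (- 1) ^ n"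
    by (rule diff_dvd_power_diff)
  then have "int (x + 1) dvd int (x ^ n + 1)"
    using assms by (simp add: add.commute)
  then show ?thesis
    by (simp only: int_dvd_int_iff)
qed

lemma Suc_dvd_power_minus_1:
  assumes "even n" "x > 0"
  shows "x + 1 dvd x ^ n - (1::nat)"
proof -
  have "int x - (- 1) dvd int x ^ n - (- 1) ^ n"
    by (rule diff_dvd_power_diff)
  then have "int (x + 1) dvd int (x ^ n - 1)"
    using assms by (simp add: add.commute of_nat_diff)
  then show ?thesis
    by (simp only: int_dvd_int_iff)
qed

lemma cong_power_gcd:
  fixes a d x y :: nat
  assumes "[a ^ x = 1] (mod d)" "[a ^ y = 1] (mod d)" "x > 0"
  shows "[a ^ gcd x y = 1] (mod d)"
proof -
  obtain i j where ij: "x * i = y * j + gcd x y"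
    using bezout_nat[of x y] assms(3) by auto
  have "[(a ^ y) ^ j * a ^ gcd x y = 1 ^ j * a ^ gcd x y] (mod d)"
    by (intro cong_mult cong_pow assms(2) cong_refl)
  moreover have "(a ^ y) ^ j * a ^ gcd x y = (a ^ x) ^ i"
    by (simp only: power_mult[symmetric] power_add[symmetric] ij)
  moreover have "[(a ^ x) ^ i = 1 ^ i] (mod d)"
    by (intro cong_pow assms(1))
  ultimately show ?thesis
    by (simp add: cong_def)
qed

text \<open>Modulo a common divisor the order of 2 divides \<open>2 * x\<close> and
  \<open>y\<close>, hence \<open>x\<close>. Then \<open>2 ^ x\<close> is both 1 and -1, so the
  divisor divides 2, but it is odd.\<close>

lemma coprime_power_plus_minus:
  assumes "gcd (2 * x) y dvd x" "x > 0" "y > 0"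
  shows "coprime (2 ^ x + 1) (2 ^ y - 1 :: nat)"
proof (rule coprimeI)
  fix d :: nat
  assume d: "d dvd 2 ^ x + 1" "d dvd 2 ^ y - 1"
  have y: "[2 ^ y = 1] (mod d)"
    using d(2) by (subst cong_altdef_nat) auto
  have "t * t - 1 = (t + 1) * (t - 1)" for t :: nat
    by (simp add: algebra_simps)
  then have "2 ^ (2 * x) - 1 = (2 ^ x + 1) * (2 ^ x - 1 :: nat)"
    by (simp only: mult_2 power_add)
  then have "d dvd 2 ^ (2 * x) - 1"
    using d(1) by (metis dvd_mult2)
  then have "[2 ^ (2 * x) = 1] (mod d)"
    by (subst cong_altdef_nat) auto
  then have g: "[2 ^ gcd (2 * x) y = 1] (mod d)"
    using y assms(2) by (intro cong_power_gcd) simp_all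
  obtain j where "x = gcd (2 * x) y * j"
    using assms(1) by (elim dvdE)
  moreover have "[(2 ^ gcd (2 * x) y) ^ j = 1 ^ j] (mod d)"
    by (intro cong_pow g)
  ultimately have "[2 ^ x = 1] (mod d)"
    by (simp flip: power_mult)
  then have "d dvd 2 ^ x - 1"
    by (subst (asm) cong_altdef_nat) auto
  then have "d dvd (2 ^ x + 1) - (2 ^ x - 1)"
    using d(1) by (rule dvd_diff_nat[rotated])
  then have "d dvd 2"
    by (simp add: numeral_2_eq_2)
  moreover have "odd d"
  proof
    assume "even d"
    then have "even (2 ^ y - 1 :: nat)"
      using d(2) by (rule dvd_trans)
    then show False
      using assms(3) by simp
  qed
  ultimately show "is_unit d"
    by (metis One_nat_def dvd_refl nat_dvd_1_iff_1 prime_nat_iff two_is_prime_nat)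
qed

lemma gcd_double_dvd:
  assumes "m dvd x" "m dvd y" "odd (y div m)"
  shows "gcd (2 * x) y dvd (x::nat)"
proof -
  obtain x' y' where xy: "x = m * x'" "y = m * y'"
    using assms(1,2) by (auto elim!: dvdE)
  have m: "m > 0"
    using assms(3) by (auto intro: Nat.gr0I)
  have "gcd (2 * x') y' dvd x'"
  proof -
    have "odd (gcd (2 * x') y')"
      using assms(3) m xy by (auto dest: dvd_trans[of 2])
    then have "coprime (gcd (2 * x') y') 2"
      by simp
    moreover have "gcd (2 * x') y' dvd 2 * x'"
      by simp
    ultimately show ?thesis
      using coprime_dvd_mult_right_iff by blast
  qed
  moreover have "gcd (2 * x) y = m * gcd (2 * x') y'"
    by (simp add: xy gcd_mult_distrib_nat mult.left_commute)
  ultimately show ?thesis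
    by (simp add: xy)
qed

lemma two_part_gcd:
  fixes x y :: nat
  assumes "x > 0" "m = 2 ^ multiplicity 2 (gcd x y)"
  shows "m dvd x" "m dvd y" "odd (x div m) \<or> odd (y div m)"
proof -
  have "m dvd gcd x y"
    unfolding assms(2) by (rule multiplicity_dvd)
  then show m: "m dvd x" "m dvd y"
    by simp_all
  show "odd (x div m) \<or> odd (y div m)"
  proof (rule ccontr)
    assume "\<not> ?thesis"
    then have "m * 2 dvd m * (x div m)" "m * 2 dvd m * (y div m)"
      by (auto intro: mult_dvd_mono)
    then have "2 * m dvd x" "2 * m dvd y"
      using m by (simp_all add: mult.commute)
    then have "2 ^ Suc (multiplicity 2 (gcd x y)) dvd gcd x y"
      by (simp add: assms(2))
    moreover have "gcd x y \<noteq> 0"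
      using assms(1) by simp
    ultimately have "Suc (multiplicity 2 (gcd x y)) \<le> multiplicity 2 (gcd x y)"
      by (intro multiplicity_geI) simp_all
    then show False
      by simp
  qed
qed

section \<open>Trace identities\<close>

context quadratic_extension
begin

lemma of_nat_parity: "(of_nat n :: 'a) = (if even n then 0 else 1)"
  using two_eq_0 by (auto elim!: evenE oddE)

lemma frobenius_sum: "finite I \<Longrightarrow> (\<Sum>i\<in>I. g i) ^ 2 ^ n = (\<Sum>i\<in>I. g i ^ 2 ^ n :: 'a)"
  by (induction I rule: finite_induct) (simp_all add: frobenius)

abbreviation tr :: "nat \<Rightarrow> 'a \<Rightarrow> 'a" where
  "tr m x \<equiv> finite_field_trace (2 ^ m) (k div m) x"

lemma trace_add: "tr m (x + y) = tr m x + tr m y"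
  by (simp add: finite_field_trace_def sum.distrib frobenius flip: power_mult)

lemma trace_1: "tr m 1 = of_nat (k div m)"
  by (simp add: finite_field_trace_def)

lemma trace_power: "tr m (x ^ 2 ^ n) = tr m x ^ 2 ^ n"
  by (simp add: finite_field_trace_def frobenius_sum flip: power_mult) (simp add: mult.commute)

text \<open>Raising to the power \<open>2 ^ m\<close> shifts the sum by one, trading the term
  \<open>x\<close> for \<open>cj x\<close>. It is stated for all \<open>x\<close>, to cover
  \<open>a\<close> with \<open>cj a = a + 1\<close>.\<close>

lemma trace_frobenius:
  assumes "m dvd k"
  shows "tr m x ^ 2 ^ m = tr m x + (cj x + x)"
proof -
  let ?n = "k div m" and ?g = "\<lambda>i. x ^ ((2 ^ m) ^ i)"
  have "tr m x ^ 2 ^ m = (\<Sum>i<?n. ?g (Suc i))"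
    by (simp add: finite_field_trace_def frobenius_sum power_mult[symmetric] mult.commute)
  also have "\<dots> = ?g 0 + (?g 0 + (\<Sum>i<?n. ?g (Suc i)))"
    by simp
  also have "?g 0 + (\<Sum>i<?n. ?g (Suc i)) = (\<Sum>i<?n. ?g i) + ?g ?n"
    by (subst sum.lessThan_Suc_shift[symmetric]) (rule sum.lessThan_Suc)
  also have "?g ?n = cj x"
    using assms unfolding cj_def by (simp add: q_def flip: power_mult)
  finally show ?thesis
    by (simp add: finite_field_trace_def ac_simps)
qed

lemma trace_frobenius_iterate:
  assumes "m dvd k" "cj x + x = d" "d = 0 \<or> d = 1"
  shows "tr m x ^ (2 ^ m) ^ j = tr m x + of_nat j * d"
proof (induction j)
  case (Suc j)
  have "tr m x ^ (2 ^ m) ^ Suc j = (tr m x ^ (2 ^ m) ^ j) ^ 2 ^ m"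
    by (simp add: power_mult[symmetric] mult.commute)
  also have "\<dots> = tr m x ^ 2 ^ m + (of_nat j * d) ^ 2 ^ m"
    by (simp only: Suc frobenius)
  also have "(of_nat j * d) ^ 2 ^ m = of_nat j * d"
    using assms(3) by (auto simp: of_nat_parity)
  finally show ?case
    unfolding trace_frobenius[OF assms(1)] assms(2) by (simp add: distrib_left distrib_right ac_simps)
qed simp

end

section \<open>Trace criterion under condition (2)\<close>

context condition2
begin

lemma mu_injective_iff_trace:
  assumes m: "m dvd k" "m dvd l" and odd: "odd (k div m) \<longleftrightarrow> even (l div m)"
  shows "mu_injective \<longleftrightarrow> tr m (1 / e) = of_nat (k div m)"
proof -
  have m_pos: "m > 0"
    using m(1) k_pos by (auto intro: Nat.gr0I)
  have qm: "q = (2 ^ m) ^ (k div m)" and Qm: "Q = (2 ^ m) ^ (l div m)"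
    using m by (simp_all add: q_def Q_def flip: power_mult)
  \<comment> \<open>The \<open>Q\<close>-th power is the \<open>2 ^ m\<close>-power iterated
    \<open>l div m\<close> times, and each iteration adds \<open>d\<close> to
    \<open>tr m a\<close>.\<close>
  have tr: "tr m (a ^ Q + a) = of_nat (l div m) * d" if "cj a + a = d" "d = 0 \<or> d = 1" for d
  proof -
    have "tr m (a ^ Q) = tr m a ^ Q"
      unfolding Q_def by (rule trace_power)
    also have "\<dots> = tr m a + of_nat (l div m) * d"
      unfolding Qm by (rule trace_frobenius_iterate[OF m(1) that])
    finally show ?thesis
      by (simp add: trace_add ac_simps)
  qed
  have N_dvd: "2 ^ m + 1 dvd CARD('a) - 1"
  proof -
    have "CARD('a) - 1 = (2 ^ m) ^ (2 * (k div m)) - 1"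
      by (simp add: card_K qm power_mult[symmetric] ac_simps)
    then show ?thesis
      using Suc_dvd_power_minus_1[of "2 * (k div m)" "2 ^ m"] by simp
  qed
  \<comment> \<open>The same \<open>z\<close> gives the collisions in both failing cases that need a
    root of unity.\<close>
  obtain z :: 'a where z: "z \<noteq> 1" "z ^ (2 ^ m + 1) = 1"
    using ex_root_of_unity[OF N_dvd] by auto
  have z_power: "z ^ n = 1" if "2 ^ m + 1 dvd n" for n
    using that z(2) by (auto elim!: dvdE simp only: power_mult power_one)
  show ?thesis
  proof (cases rule: inverse_e_cases)
    case 1
    show ?thesis
    proof (cases "cj a = a")
      case True
      then have "tr m (1 / e) = of_nat (k div m)"
        using tr[of 0] by (simp add: 1 trace_add trace_1)
      then show ?thesis
        using mu_injective_split_parallel[OF 1 True] by simp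
    next
      case False
      then have nonsplit: "cj a = a + 1"
        using a_conj by simp
      have tr_e: "tr m (1 / e) = of_nat (l div m) + of_nat (k div m)"
        using tr[of 1] by (simp add: 1 trace_add trace_1 nonsplit ac_simps)
      show ?thesis
      proof (cases "odd (k div m)")
        case True
        have "coprime (Q + 1) (q - 1)"
          unfolding Q_def q_def
          by (rule coprime_power_plus_minus[OF gcd_double_dvd[OF m(2,1) True] l_pos k_pos])
        then show ?thesis
          using mu_injective_nonsplit_parallel[OF 1 nonsplit] odd True
          by (simp add: tr_e of_nat_parity)
      next
        case False
        have "2 ^ m + 1 dvd Q + 1"
          unfolding Qm using odd False by (intro Suc_dvd_power_Suc) simp
        moreover have "2 ^ m + 1 dvd q - 1"
          unfolding qm using False by (intro Suc_dvd_power_minus_1) simp_all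
        ultimately have "\<not> mu_injective"
          by (intro not_mu_injective_nonsplit_parallel[OF 1 nonsplit z(1)] z_power)
        then show ?thesis
          using odd False
          by (simp add: tr_e of_nat_parity)
      qed
    qed
  next
    case 2
    show ?thesis
    proof (cases "cj a = a")
      case True
      then have tr_e: "tr m (1 / e) = 0"
        using tr[of 0] by (simp add: 2)
      show ?thesis
      proof (cases "odd (k div m)")
        case odd_k: True
        have "2 ^ m + 1 dvd Q - 1"
          unfolding Qm using odd odd_k by (intro Suc_dvd_power_minus_1) simp_all
        moreover have "2 ^ m + 1 dvd q + 1"
          unfolding qm using odd_k by (intro Suc_dvd_power_Suc) simp
        ultimately have "\<not> mu_injective"
          by (intro not_mu_injective_split_crossed[OF 2 True z(1)] z_power)
        then show ?thesis
          using odd_k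
          by (simp add: tr_e of_nat_parity)
      next
        case even_k: False
        then have "odd (l div m)"
          using odd by simp
        then have "coprime (q + 1) (Q - 1)"
          unfolding Q_def q_def
          by (intro coprime_power_plus_minus[OF gcd_double_dvd[OF m] k_pos l_pos])
        then show ?thesis
          using mu_injective_split_crossed[OF 2 True] even_k
          by (simp add: tr_e of_nat_parity coprime_commute)
      qed
    next
      case False
      then have nonsplit: "cj a = a + 1"
        using a_conj by simp
      have "tr m (1 / e) = of_nat (l div m)"
        using tr[of 1] by (simp add: 2 nonsplit ac_simps)
      then show ?thesis
        using not_mu_injective_nonsplit_crossed[OF 2 nonsplit] odd
        by (simp add: of_nat_parity)
    qed
  qed
qed

end

context projective_map
begin

lemma mu_injective_monomial:
  assumes "b = 0" "c = 0"
  shows mu_injective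
proof -
  have "y = z" if "y \<in> mu" "z \<in> mu" "y ^ (Q + 1) = z ^ (Q + 1)" for y z
    using power_eq_coprime[OF that(3) _ coprime_Q_q] that mu_nonzero unfolding mu_iff by simp
  moreover have "D y = 1" "N y = y ^ (Q + 1)" for y
    unfolding D_def N_def using assms by simp_all
  ultimately show ?thesis
    unfolding mu_injective_def by simp
qed

lemma mu_injective_iff:
  assumes m: "m dvd k" "m dvd l" and odd: "odd (k div m) \<longleftrightarrow> even (l div m)"
  shows "mu_injective \<longleftrightarrow>
    e \<noteq> 0 \<and> c ^ Q = e ^ (Q - 1) * b \<and> tr m (1 / e) = of_nat (k div m)"
proof (cases "e = 0")
  case True
  then show ?thesis
    using mu_injective_imp_e_nonzero by blast
next
  case e_nonzero: False
  show ?thesis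
  proof (cases "b = 0")
    \<comment> \<open>Treated apart, since the roots \<open>r\<close> and \<open>r'\<close> require
      division by \<open>bt\<close>.\<close>
    case b: True
    show ?thesis
    proof (cases "c = 0")
      case True
      have "e = 1"
        unfolding e_def using b True by simp
      then show ?thesis
        using mu_injective_monomial[OF b True] b True Q_gt_1 by (simp add: trace_1 zero_power)
    next
      case False
      then show ?thesis
        using c_zero_if_b_zero b by auto
    qed
  next
    case b_nonzero: False
    obtain bt where bt: "bt ^ Q = b"
      using power_Q_surj by blast
    obtain ep where ep: "ep ^ Q = e"
      using power_Q_surj by blast
    have nz: "bt \<noteq> 0" "ep \<noteq> 0"
      using bt ep b_nonzero e_nonzero Q_gt_1 by (auto simp: zero_power)
    have "cj ep = ep"
      by (rule power_Q_inj) (simp add: ep flip: cj_power)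
    then have "cj (bt * cj bt / ep\<^sup>2) = bt * cj bt / ep\<^sup>2"
      by (simp add: cj_simps mult.commute)
    then obtain a where a: "a\<^sup>2 + a = bt * cj bt / ep\<^sup>2"
      using artin_schreier_solvable by blast
    interpret ramification k q K l Q b c bt ep a "ep * a / bt" "ep * (a + 1) / bt"
      by unfold_locales (use bt ep nz a in simp_all)
    show ?thesis
    proof (cases "c = ep ^ (Q - 1) * bt")
      case True
      interpret condition2 k q K l Q b c bt ep a "ep * a / bt" "ep * (a + 1) / bt"
        by unfold_locales (fact True)
      show ?thesis
        using mu_injective_iff_trace[OF m odd] True e_nonzero unfolding condition2_iff by blast
    next
      case False
      moreover have "\<not> mu_injective"
        using False condition2_split condition2_nonsplit a_conj by blast
      ultimately show ?thesis
        unfolding condition2_iff by blast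
    qed
  qed
qed

end

theorem corollary9p4:
  fixes k l m q Q u v :: nat
    and b c e :: "'a::{field,finite}"
    and A f :: "'a poly"
  assumes "k > 0" and "l > 0"
    and "m = 2 ^ multiplicity 2 (gcd k l)"
    and "q = 2 ^ k" and "Q = 2 ^ l"
    and "gcd (Q + 1) (q + 1) = 1"
    and "CARD('a) = q ^ 2"
    and "u > 0" and "v > 0"
    and "[u * (Q + 1) = 1] (mod (q + 1))"
    and "[v * (Q + 1) = Q] (mod (q + 1))"
    and "A = 1 + monom b v + monom c u"
    and "f = monom 1 1 * pcompose A (monom 1 (q - 1))"
    and "e = 1 + b ^ (q + 1) + c ^ (q + 1)"
  shows "permutes_field f \<longleftrightarrow>
    e \<noteq> 0 \<and>
    c ^ Q = e ^ (Q - 1) * b \<and>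
    finite_field_trace (2 ^ m) (k div m) (1 / e) = of_nat (k div m)"
proof -
  interpret projective_map k q "TYPE('a)" l Q b c
    by unfold_locales (use assms in \<open>simp_all add: coprime_iff_gcd_eq_1\<close>)
  have e: "e = projective_map.e q b c"
    unfolding assms(14) e_def power_q_plus_1 ..
  note m = two_part_gcd[OF \<open>k > 0\<close> assms(3)]
  \<comment> \<open>Here the coprimality of \<open>Q + 1\<close> and \<open>q + 1\<close> enters:
    with both quotients odd, \<open>2 ^ m + 1\<close> would divide both numbers. So exactly one
    quotient is odd.\<close>
  have "\<not> (odd (k div m) \<and> odd (l div m))"
  proof
    assume "odd (k div m) \<and> odd (l div m)"
    then have "2 ^ m + 1 dvd (2 ^ m) ^ (l div m) + (1::nat)" "2 ^ m + 1 dvd (2 ^ m) ^ (k div m) + (1::nat)"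
      using Suc_dvd_power_Suc by blast+
    then have "2 ^ m + 1 dvd gcd (Q + 1) (q + 1)"
      using m(1,2) by (simp add: assms(4,5) power_mult[symmetric])
    then show False
      unfolding assms(6) by simp
  qed
  then have "odd (k div m) \<longleftrightarrow> even (l div m)"
    using m(3) by blast
  then show ?thesis
    using permutes_iff_mu_injective[OF assms(10-13)] mu_injective_iff[OF m(1,2)] unfolding e by simp
qed

end
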